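(* Let $U\in L^\infty(\mathbb{R})$ and $V\in L^\infty(\mathbb{R})\cap W_2^1(\mathbb{R})$ be real-valued functions of compact support, and let $\{\alpha_\lambda\}_{\lambda>0}$ be positive numbers with $\alpha_\lambda\to\alpha$ as $\lambda\to0$ for some $\alpha>0$. Let $H_\lambda=-\frac{d^2}{dx^2}+U(x)+\lambda\alpha_\lambda V(\alpha_\lambda x)$ on $W_2^2(\mathbb{R})$ and $H_0=-\frac{d^2}{dx^2}+U$. Suppose $H_0$ has a zero-energy resonance with normalized half-bound state $u$, and let $\theta=\lim_{x\to+\infty}u(x)$. If $$\int_{\mathbb{R}}V(\alpha x)u^2(x)\,dx=0,\qquad \int_{\mathbb{R}}xV'(\alpha x)u^2(x)\,dx<0,$$ and $\lambda^{-1/3}(\alpha_\lambda-\alpha)\to\infty$ as $\lambda\to0$, then $H_\lambda$ has the coupling constant threshold $\lambda=0$, and the threshold eigenvalue satisfies $$e_\lambda=-\lambda^2(\alpha_\lambda-\alpha)^2\left(\Big(\frac{\alpha}{\theta^2+1}\int_{\mathbb{R}}xV'(\alpha x)u^2(x)\,dx\Big)^2+o(1)\right)\quad\text{as }\lambda\to0.$$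
   Context: $H_0$ possesses a zero-energy resonance if there is a nontrivial solution $h$ of $-h''+Uh=0$ bounded on $\mathbb{R}$ (a half-bound state); its limits $h_\pm=\lim_{x\to\pm\infty}h(x)$ exist and are nonzero, and the normalized half-bound state is $u=h/h_-$ (so $u\to1$ as $x\to-\infty$). The coupling constant threshold $\lambda=0$ means: for all small $\lambda>0$, $H_\lambda$ has a negative eigenvalue $e_\lambda$ (below the essential spectrum $[0,\infty)$) with $e_\lambda\to0$ as $\lambda\to0$. *)

theory Defs
  imports "HOL-Analysis.Analysis"
begin

text \<open>Absolute continuity on every compact interval, with (a.e.) derivative g:
  f b - f a equals the Lebesgue integral of g over [a,b].\<close>
definition has_ac_deriv ::
  "(real \<Rightarrow> 'a::{banach,second_countable_topology}) \<Rightarrow> (real \<Rightarrow> 'a) \<Rightarrow> bool" where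
  "has_ac_deriv f g \<longleftrightarrow>
     (\<forall>a b. a \<le> b \<longrightarrow> set_integrable lborel {a..b} g \<and>
        f b - f a = (LINT t:{a..b}|lborel. g t))"

definition sq_integrable :: "(real \<Rightarrow> 'a::{banach,second_countable_topology}) \<Rightarrow> bool" where
  "sq_integrable f \<longleftrightarrow> f \<in> borel_measurable lborel \<and> integrable lborel (\<lambda>x. (norm (f x))^2)"

definition in_W22 :: "(real \<Rightarrow> complex) \<Rightarrow> (real \<Rightarrow> complex) \<Rightarrow> bool" where
  "in_W22 psi psi2 \<longleftrightarrow> (\<exists>psi1. has_ac_deriv psi psi1 \<and> has_ac_deriv psi1 psi2 \<and>
     sq_integrable psi \<and> sq_integrable psi1 \<and> sq_integrable psi2)"

definition schr_eigenvalue :: "(real \<Rightarrow> real) \<Rightarrow> real \<Rightarrow> bool" where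
  "schr_eigenvalue W e \<longleftrightarrow> (\<exists>psi psi2. in_W22 psi psi2 \<and> (\<exists>x. psi x \<noteq> 0) \<and>
     (AE x in lborel. - psi2 x + complex_of_real (W x) * psi x = complex_of_real e * psi x))"

definition half_bound_state :: "(real \<Rightarrow> real) \<Rightarrow> (real \<Rightarrow> real) \<Rightarrow> bool" where
  "half_bound_state U h \<longleftrightarrow> (\<exists>h1 h2. has_ac_deriv h h1 \<and> has_ac_deriv h1 h2 \<and>
     (AE x in lborel. - h2 x + U x * h x = 0)) \<and> bounded (range h) \<and> (\<exists>x. h x \<noteq> 0)"

definition threshold_eigenvalue :: "(real \<Rightarrow> real \<Rightarrow> real) \<Rightarrow> (real \<Rightarrow> real) \<Rightarrow> bool" where
  "threshold_eigenvalue W e \<longleftrightarrow>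
     (\<forall>\<^sub>F lam in at_right 0. e lam < 0 \<and> schr_eigenvalue (W lam) (e lam)) \<and>
     (e \<longlongrightarrow> 0) (at_right 0)"

definition coupling_constant_threshold :: "(real \<Rightarrow> real \<Rightarrow> real) \<Rightarrow> bool" where
  "coupling_constant_threshold W \<longleftrightarrow> (\<exists>e. threshold_eigenvalue W e)"

end

theory Submission
  imports Defs
begin

text \<open>
  Outside a common interval \<open>[-R, R]\<close> all potentials vanish, so \<open>- k\<^sup>2\<close> with \<open>k > 0\<close> is an eigenvalue
  iff the solution \<open>f\<close> of \<open>f'' = (W + k\<^sup>2) f\<close> with \<open>f (-R) = 1\<close>, \<open>f' (-R) = k\<close> satisfies
  \<open>D k = f' R + k f R = 0\<close>. The half-bound state is \<open>1\<close> left and \<open>\<theta>\<close> right of the interval. Integrating the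
  derivative of the Wronskian of \<open>f\<close> and \<open>u\<close>, and using \<open>f = u + O(k + \<lambda>)\<close> (Gronwall), gives
  \<open>\<theta> D k = k (1 + \<theta>\<^sup>2) + \<lambda> F(\<alpha>\<^sub>\<lambda>) + O((k + \<lambda>)\<^sup>2)\<close> with \<open>F b = \<integral> b V(b x) u\<^sup>2\<close>. Here \<open>F \<alpha> = 0\<close> and
  \<open>F' \<alpha> = \<alpha> \<integral> x V'(\<alpha> x) u\<^sup>2 < 0\<close>, while \<open>\<lambda>\<^sup>2 = o(\<lambda> (\<alpha>\<^sub>\<lambda> - \<alpha>))\<close>; hence a small root \<open>k\<close> exists, and every
  small root is asymptotic to \<open>- \<lambda> (\<alpha>\<^sub>\<lambda> - \<alpha>) F' \<alpha> / (1 + \<theta>\<^sup>2)\<close>.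
\<close>

section \<open>Absolutely continuous functions\<close>

text \<open>The potential U is merely bounded and measurable and V merely absolutely continuous, so
  second derivatives exist only almost everywhere and calculus is done on integrated identities. The
  Wronskian survives this because each of its products pairs an absolutely continuous first
  derivative with a continuously differentiable solution. The exponent k is unknown when the
  expansion is made, so the remainder must be uniform in k and \<open>lam\<close>: its constant is
  fixed before either is chosen. The root is then caught by a sign change between two multiples of
  \<open>lam * (a lam - \<alpha>)\<close>. The asymptotics, in contrast, uses only the
  characteristic equation and k -> 0, so it holds for every family of eigenvalues tending to 0,
  without uniqueness or a continuous choice of the root.\<close>

definition loc_integrable :: "(real \<Rightarrow> real) \<Rightarrow> bool" where
  "loc_integrable g \<longleftrightarrow> (\<forall>a b. set_integrable lborel {a..b} g)"

lemma loc_integrableD: "loc_integrable g \<Longrightarrow> set_integrable lborel {a..b} g"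
  by (simp add: loc_integrable_def)

lemma has_ac_deriv_loc_integrable: "has_ac_deriv f g \<Longrightarrow> loc_integrable g"
  unfolding has_ac_deriv_def loc_integrable_def
  by (metis atLeastatMost_empty linorder_not_le set_integrable_empty)

lemma has_ac_derivD: "has_ac_deriv f g \<Longrightarrow> a \<le> b \<Longrightarrow> f b - f a = (LINT t:{a..b}|lborel. g t)"
  by (simp add: has_ac_deriv_def)

lemma has_ac_derivI:
  "loc_integrable g \<Longrightarrow> (\<And>a b. a \<le> b \<Longrightarrow> f b - f a = (LINT t:{a..b}|lborel. g t)) \<Longrightarrow> has_ac_deriv f g"
  by (simp add: has_ac_deriv_def loc_integrable_def)

lemma loc_integrable_continuous: "continuous_on UNIV g \<Longrightarrow> loc_integrable g"
  unfolding loc_integrable_def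
  by (auto intro!: borel_integrable_atLeastAtMost' elim: continuous_on_subset)

lemma set_integral_Icc_split:
  fixes g :: "real \<Rightarrow> real"
  assumes "loc_integrable g" "a \<le> b" "b \<le> c"
  shows "(LINT t:{a..c}|lborel. g t) = (LINT t:{a..b}|lborel. g t) + (LINT t:{b..c}|lborel. g t)"
  using assms Henstock_Kurzweil_Integration.integral_combine[of a b c g]
  by (simp add: set_borel_integral_eq_integral loc_integrableD)

lemma set_integral_Icc_refl:
  fixes g :: "real \<Rightarrow> real"
  assumes "loc_integrable g"
  shows "(LINT t:{a..a}|lborel. g t) = 0"
  using set_integral_Icc_split[OF assms order_refl order_refl, of a] by linarith

lemma has_ac_deriv_continuous:
  fixes f :: "real \<Rightarrow> real"
  assumes "has_ac_deriv f g"
  shows "continuous_on UNIV f"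
proof -
  note li = loc_integrableD[OF has_ac_deriv_loc_integrable[OF assms]]
  have "isCont f x" for x
  proof -
    have "continuous_on {x-1..x+1} (\<lambda>y. f (x-1) + integral {x-1..y} g)"
      by (intro continuous_intros indefinite_integral_continuous_1 set_borel_integral_eq_integral(1) li)
    moreover have "f (x-1) + integral {x-1..y} g = f y" if "y \<in> {x-1..x+1}" for y
      using has_ac_derivD[OF assms, of "x-1" y] that
      by (simp add: set_borel_integral_eq_integral(2)[OF li])
    ultimately have "continuous_on {x-1..x+1} f"
      by (metis (no_types, lifting) continuous_on_cong)
    then show ?thesis
      by (rule continuous_on_interior) (simp add: interior_atLeastAtMost_real)
  qed
  then show ?thesis by (simp add: continuous_at_imp_continuous_on)
qed

text \<open>With a continuous density the fundamental theorem of calculus applies at every point.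
  This makes solutions continuously differentiable in the classical sense, which the Gronwall
  argument and the Leibniz rule rely on.\<close>

lemma has_ac_deriv_DERIV:
  fixes f :: "real \<Rightarrow> real"
  assumes f: "has_ac_deriv f g" and g: "continuous_on UNIV g"
  shows "DERIV f x :> g x"
proof -
  note li = loc_integrableD[OF has_ac_deriv_loc_integrable[OF f]]
  have "((\<lambda>y. integral {x-1..y} g) has_real_derivative g x) (at x within {x-1..x+1})"
    by (rule integral_has_real_derivative) (auto intro: continuous_on_subset[OF g])
  then have "((\<lambda>y. f (x-1) + integral {x-1..y} g) has_real_derivative g x) (at x within {x-1..x+1})"
    by (auto intro!: derivative_eq_intros)
  moreover have "f (x-1) + integral {x-1..y} g = f y" if "y \<in> {x-1..x+1}" for y
    using has_ac_derivD[OF f, of "x-1" y] that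
    by (simp add: set_borel_integral_eq_integral(2)[OF li])
  ultimately have "(f has_real_derivative g x) (at x within {x-1..x+1})"
    by (elim has_field_derivative_transform_within[where d=1]) auto
  then show ?thesis
    using at_within_interior[of x "{x-1..x+1}"] by simp
qed

lemma DERIV_has_ac_deriv:
  fixes f :: "real \<Rightarrow> real"
  assumes "\<And>x. DERIV f x :> g x" and g: "continuous_on UNIV g"
  shows "has_ac_deriv f g"
proof (rule has_ac_derivI)
  show "loc_integrable g" using g by (rule loc_integrable_continuous)
  fix a b :: real assume "a \<le> b"
  have "(\<integral>x. g x * indicator {a .. b} x \<partial>lborel) = f b - f a"
    using assms by (intro integral_FTC_Icc_real \<open>a \<le> b\<close>) (auto simp: continuous_on_eq_continuous_at)
  then show "f b - f a = (LINT t:{a..b}|lborel. g t)"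
    by (simp add: set_lebesgue_integral_def mult.commute)
qed

section \<open>Closure properties of locally integrable and of absolutely continuous
  functions\<close>

lemma loc_integrable_add: "loc_integrable f \<Longrightarrow> loc_integrable g \<Longrightarrow> loc_integrable (\<lambda>x. f x + g x)"
  by (simp add: loc_integrable_def set_integral_add)

lemma loc_integrable_diff: "loc_integrable f \<Longrightarrow> loc_integrable g \<Longrightarrow> loc_integrable (\<lambda>x. f x - g x)"
  by (simp add: loc_integrable_def set_integral_diff)

lemma loc_integrable_cmult: "loc_integrable f \<Longrightarrow> loc_integrable (\<lambda>x. c * f x)"
  by (simp add: loc_integrable_def)

lemma loc_integrable_abs: "loc_integrable f \<Longrightarrow> loc_integrable (\<lambda>x. \<bar>f x\<bar>)"
  by (simp add: loc_integrable_def set_integrable_abs)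

lemma loc_integrable_mult:
  assumes f: "loc_integrable f" and g: "g \<in> borel_measurable lborel"
    and bdd: "\<And>a b. \<exists>B. \<forall>x\<in>{a..b}. \<bar>g x\<bar> \<le> B"
  shows "loc_integrable (\<lambda>x. f x * g x)"
  unfolding loc_integrable_def
proof (intro allI)
  fix a b :: real
  obtain B where B: "\<forall>x\<in>{a..b}. \<bar>g x\<bar> \<le> B" using bdd by blast
  have fi: "integrable lborel (\<lambda>x. indicator {a..b} x *\<^sub>R f x)"
    using loc_integrableD[OF f] by (simp add: set_integrable_def)
  have "integrable lborel (\<lambda>x. (indicator {a..b} x *\<^sub>R f x) * g x)"
  proof (rule Bochner_Integration.integrable_bound)
    show "integrable lborel (\<lambda>x. B * (indicator {a..b} x *\<^sub>R f x))"
      using fi by (intro integrable_mult_right) simp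
    show "(\<lambda>x. (indicator {a..b} x *\<^sub>R f x) * g x) \<in> borel_measurable lborel"
      using borel_measurable_integrable[OF fi] g by (rule borel_measurable_times)
    show "AE x in lborel. norm ((indicator {a..b} x *\<^sub>R f x) * g x) \<le> norm (B * (indicator {a..b} x *\<^sub>R f x))"
    proof (intro AE_I2)
      fix x
      have "\<bar>g x\<bar> * \<bar>f x\<bar> \<le> \<bar>B\<bar> * \<bar>f x\<bar>" if "x \<in> {a..b}"
        using B that by (intro mult_right_mono) force+
      then show "norm ((indicator {a..b} x *\<^sub>R f x) * g x) \<le> norm (B * (indicator {a..b} x *\<^sub>R f x))"
        by (simp add: indicator_def abs_mult mult.commute)
    qed
  qed
  then show "set_integrable lborel {a..b} (\<lambda>x. f x * g x)"
    by (simp add: set_integrable_def mult.assoc)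
qed

lemma continuous_bounded_Icc:
  fixes g :: "real \<Rightarrow> real"
  assumes "continuous_on UNIV g"
  shows "\<exists>B. \<forall>x\<in>{a..b}. \<bar>g x\<bar> \<le> B"
proof -
  have "bounded (g ` {a..b})"
    by (intro compact_imp_bounded compact_continuous_image continuous_on_subset[OF assms]) auto
  then show ?thesis by (auto simp: bounded_iff)
qed

lemma loc_integrable_mult_continuous:
  assumes "loc_integrable f" "continuous_on UNIV g"
  shows "loc_integrable (\<lambda>x. f x * g x)"
  using assms continuous_bounded_Icc[OF assms(2)]
  by (intro loc_integrable_mult) (auto intro: borel_measurable_continuous_onI)

lemma loc_integrable_bounded_mult_continuous:
  assumes "Q \<in> borel_measurable lborel" "\<And>x. \<bar>Q x\<bar> \<le> B" "continuous_on UNIV g"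
  shows "loc_integrable (\<lambda>x. Q x * g x)"
proof -
  have "loc_integrable (\<lambda>x. g x * Q x)"
    using assms by (intro loc_integrable_mult loc_integrable_continuous) auto
  then show ?thesis by (simp add: mult.commute)
qed

lemma abs_set_integral_le:
  assumes "loc_integrable f" "loc_integrable g" "\<And>t. t \<in> {a..b} \<Longrightarrow> \<bar>f t\<bar> \<le> g t"
  shows "\<bar>LINT t:{a..b}|lborel. f t\<bar> \<le> (LINT t:{a..b}|lborel. g t)"
proof -
  have "norm (LINT t:{a..b}|lborel. f t) \<le> (LINT t:{a..b}|lborel. norm (f t))"
    by (rule set_integral_norm_bound) (rule loc_integrableD[OF assms(1)])
  also have "\<dots> \<le> (LINT t:{a..b}|lborel. g t)"
    using assms by (intro set_integral_mono) (auto intro: loc_integrableD loc_integrable_abs)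
  finally show ?thesis by simp
qed

lemma set_integral_Icc_const: "a \<le> b \<Longrightarrow> (LINT t:{a..b}|lborel. c) = c * (b - a)" for a b c :: real
  by (simp add: set_lebesgue_integral_def)

lemma has_ac_deriv_add:
  fixes f g :: "real \<Rightarrow> real"
  assumes "has_ac_deriv f f'" "has_ac_deriv g g'"
  shows "has_ac_deriv (\<lambda>x. f x + g x) (\<lambda>x. f' x + g' x)"
  using assms by (simp add: has_ac_deriv_def set_integral_add algebra_simps)

lemma has_ac_deriv_cmult:
  fixes f :: "real \<Rightarrow> real"
  assumes "has_ac_deriv f f'"
  shows "has_ac_deriv (\<lambda>x. c * f x) (\<lambda>x. c * f' x)"
  using assms by (simp add: has_ac_deriv_def right_diff_distrib[symmetric])

lemma has_ac_deriv_diff: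
  fixes f g :: "real \<Rightarrow> real"
  assumes "has_ac_deriv f f'" "has_ac_deriv g g'"
  shows "has_ac_deriv (\<lambda>x. f x - g x) (\<lambda>x. f' x - g' x)"
  using assms by (simp add: has_ac_deriv_def set_integral_diff algebra_simps)

text \<open>Densities enter only through integrals, so null sets are invisible. This turns a
  differential equation that holds almost everywhere into one whose second derivative is literally
  the potential times the function.\<close>

lemma has_ac_deriv_cong_AE:
  fixes f :: "real \<Rightarrow> real"
  assumes f: "has_ac_deriv f g" and g': "loc_integrable g'" and AE: "AE x in lborel. g x = g' x"
  shows "has_ac_deriv f g'"
proof (rule has_ac_derivI[OF g'])
  fix a b :: real assume "a \<le> b"
  have 1: "(\<lambda>x. indicator {a..b} x *\<^sub>R g x) \<in> borel_measurable lborel"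
    using loc_integrableD[OF has_ac_deriv_loc_integrable[OF f]] unfolding set_integrable_def by blast
  have 2: "(\<lambda>x. indicator {a..b} x *\<^sub>R g' x) \<in> borel_measurable lborel"
    using loc_integrableD[OF g'] unfolding set_integrable_def by blast
  have "(LINT t:{a..b}|lborel. g t) = (LINT t:{a..b}|lborel. g' t)"
    unfolding set_lebesgue_integral_def
    by (rule integral_cong_AE[OF 1 2]) (use AE in auto)
  then show "f b - f a = (LINT t:{a..b}|lborel. g' t)"
    using has_ac_derivD[OF f \<open>a \<le> b\<close>] by simp
qed

text \<open>Subdividing into \<open>n\<close> equal parts gives the bound \<open>C (b - a) (N b - N a) / n\<close>.\<close>
lemma eq_if_superlinear_increments:
  fixes H N :: "real \<Rightarrow> real"
  assumes "a \<le> b"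
    and inc: "\<And>x y. a \<le> x \<Longrightarrow> x \<le> y \<Longrightarrow> y \<le> b \<Longrightarrow> \<bar>H y - H x\<bar> \<le> C * (y - x) * (N y - N x)"
  shows "H b = H a"
proof -
  have bound: "\<bar>H b - H a\<bar> \<le> C * (b - a) * (N b - N a) / real n" if n: "n > 0" for n :: nat
  proof -
    define z where "z i = a + real i * (b - a) / real n" for i :: nat
    have step: "z (Suc i) - z i = (b - a) / n" for i
      by (simp add: z_def ring_distribs add_divide_distrib diff_divide_distrib)
    have "\<bar>H (z i) - H a\<bar> \<le> C * ((b - a) / n) * (N (z i) - N a)" if "i \<le> n" for i
      using that
    proof (induction i)
      case 0
      then show ?case by (simp add: z_def)
    next
      case (Suc i)
      have "a \<le> z i" using \<open>a \<le> b\<close> by (simp add: z_def)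
      moreover have "z i \<le> z (Suc i)" using step[of i] \<open>a \<le> b\<close> n
        by (metis diff_ge_0_iff_ge divide_nonneg_nonneg of_nat_0_le_iff)
      moreover have "z (Suc i) \<le> b"
      proof -
        have "real (Suc i) * (b - a) / n \<le> real n * (b - a) / n"
          using Suc.prems \<open>a \<le> b\<close> by (intro divide_right_mono mult_right_mono) auto
        then show ?thesis using n by (simp add: z_def)
      qed
      ultimately have "\<bar>H (z (Suc i)) - H (z i)\<bar> \<le> C * ((b - a) / n) * (N (z (Suc i)) - N (z i))"
        using inc[of "z i" "z (Suc i)"] step[of i] by simp
      moreover have "\<bar>H (z i) - H a\<bar> \<le> C * ((b - a) / n) * (N (z i) - N a)"
        using Suc by simp
      moreover have "r * (N (z (Suc i)) - N (z i)) + r * (N (z i) - N a) = r * (N (z (Suc i)) - N a)" for r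
        by (simp add: algebra_simps)
      ultimately show ?case by (smt (verit))
    qed
    from this[of n] n show ?thesis by (simp add: z_def)
  qed
  have "(\<lambda>n. C * (b - a) * (N b - N a) / real n) \<longlonglongrightarrow> 0"
    by (rule lim_const_over_n)
  moreover have "\<forall>\<^sub>F n in sequentially. \<bar>H b - H a\<bar> \<le> C * (b - a) * (N b - N a) / real n"
    using eventually_gt_at_top[of 0] by eventually_elim (rule bound)
  ultimately have "\<bar>H b - H a\<bar> \<le> 0"
    by (intro tendsto_lowerbound[of _ 0 sequentially]) auto
  then show ?thesis by simp
qed

text \<open>On [a, b] the factor g is Lipschitz with constant K, and increments of f are bounded by
  those of the variation N, the integral of |f'|. Hence the defect H of the product formula has
  increments at most 2 K (y - x) (N y - N x), which forces it to be constant.\<close>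

lemma has_ac_deriv_mult:
  fixes f g :: "real \<Rightarrow> real"
  assumes f: "has_ac_deriv f f'" and g: "has_ac_deriv g g'" and g': "continuous_on UNIV g'"
  shows "has_ac_deriv (\<lambda>x. f x * g x) (\<lambda>x. f' x * g x + f x * g' x)"
proof (rule has_ac_derivI)
  note cf = has_ac_deriv_continuous[OF f] and cg = has_ac_deriv_continuous[OF g]
  note lf = has_ac_deriv_loc_integrable[OF f] and lg = has_ac_deriv_loc_integrable[OF g]
  have l1: "loc_integrable (\<lambda>x. f' x * g x)" by (intro loc_integrable_mult_continuous lf cg)
  have l2: "loc_integrable (\<lambda>x. f x * g' x)"
    by (intro loc_integrable_mult_continuous loc_integrable_continuous cf g')
  show l: "loc_integrable (\<lambda>x. f' x * g x + f x * g' x)" by (intro loc_integrable_add l1 l2)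
  fix a b :: real assume "a \<le> b"
  obtain K where K: "\<And>x. x \<in> {a..b} \<Longrightarrow> \<bar>g' x\<bar> \<le> K"
    using continuous_bounded_Icc[OF g'] by blast
  have K0: "K \<ge> 0" using K[of a] \<open>a \<le> b\<close> by auto
  define h where "h x = f' x * g x + f x * g' x" for x
  define H where "H x = f x * g x - (LINT t:{a..x}|lborel. h t)" for x
  define N where "N x = (LINT t:{a..x}|lborel. \<bar>f' t\<bar>)" for x
  have "H b = H a"
  proof (rule eq_if_superlinear_increments[OF \<open>a \<le> b\<close>])
    fix x y assume xy: "a \<le> x" "x \<le> y" "y \<le> b"
    have Ndiff: "N y - N x = (LINT t:{x..y}|lborel. \<bar>f' t\<bar>)"
      using set_integral_Icc_split[OF loc_integrable_abs[OF lf] xy(1,2)] by (simp add: N_def)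
    have "H y - H x = (f y * g y - f x * g x) - (LINT t:{x..y}|lborel. h t)"
      using set_integral_Icc_split[OF l xy(1,2)] by (simp add: H_def h_def)
    \<comment> \<open>This splitting freezes g at the right end and f at the left end, so both terms
      become integrals of f' or g' with a constant factor and can be compared with the integrals in
      h.\<close>
    also have "f y * g y - f x * g x = (f y - f x) * g y + f x * (g y - g x)"
      by (simp add: algebra_simps)
    also have "\<dots> = (LINT t:{x..y}|lborel. f' t * g y) + (LINT t:{x..y}|lborel. f x * g' t)"
      using has_ac_derivD[OF f xy(2)] has_ac_derivD[OF g xy(2)] by simp
    also have "(LINT t:{x..y}|lborel. h t) = (LINT t:{x..y}|lborel. f' t * g t) + (LINT t:{x..y}|lborel. f t * g' t)"
      unfolding h_def by (intro set_integral_add loc_integrableD l1 l2)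
    finally have "H y - H x = ((LINT t:{x..y}|lborel. f' t * g y) - (LINT t:{x..y}|lborel. f' t * g t))
       + ((LINT t:{x..y}|lborel. f x * g' t) - (LINT t:{x..y}|lborel. f t * g' t))" by simp
    also have "(LINT t:{x..y}|lborel. f' t * g y) - (LINT t:{x..y}|lborel. f' t * g t)
       = (LINT t:{x..y}|lborel. f' t * g y - f' t * g t)"
      by (intro set_integral_diff(2)[symmetric] loc_integrableD l1 loc_integrable_mult_continuous lf) simp
    also have "(LINT t:{x..y}|lborel. f x * g' t) - (LINT t:{x..y}|lborel. f t * g' t)
       = (LINT t:{x..y}|lborel. f x * g' t - f t * g' t)"
      by (intro set_integral_diff(2)[symmetric] loc_integrableD l2 loc_integrable_cmult lg)
    finally have eq: "H y - H x = (LINT t:{x..y}|lborel. f' t * g y - f' t * g t) +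
      (LINT t:{x..y}|lborel. f x * g' t - f t * g' t)" .
    have b1: "\<bar>LINT t:{x..y}|lborel. f' t * g y - f' t * g t\<bar> \<le> (LINT t:{x..y}|lborel. (K * (y - x)) * \<bar>f' t\<bar>)"
    proof (rule abs_set_integral_le)
      fix t assume t: "t \<in> {x..y}"
      have "\<bar>g y - g t\<bar> \<le> (LINT s:{t..y}|lborel. K)"
        using has_ac_derivD[OF g, of t y] t xy K
        by (auto intro!: abs_set_integral_le lg loc_integrable_continuous)
      also have "\<dots> = K * (y - t)" using t by (intro set_integral_Icc_const) auto
      also have "\<dots> \<le> K * (y - x)" using t K0 by (intro mult_left_mono) auto
      finally have "\<bar>f' t\<bar> * \<bar>g y - g t\<bar> \<le> \<bar>f' t\<bar> * (K * (y - x))"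
        by (rule mult_left_mono) simp
      then show "\<bar>f' t * g y - f' t * g t\<bar> \<le> K * (y - x) * \<bar>f' t\<bar>"
        by (simp add: abs_mult[symmetric] algebra_simps)
    qed (intro loc_integrable_diff loc_integrable_cmult loc_integrable_abs lf l1 loc_integrable_mult_continuous continuous_intros)+
    have b2: "\<bar>LINT t:{x..y}|lborel. f x * g' t - f t * g' t\<bar> \<le> (LINT t:{x..y}|lborel. (N y - N x) * K)"
    proof (rule abs_set_integral_le)
      fix t assume t: "t \<in> {x..y}"
      have "\<bar>f t - f x\<bar> \<le> (LINT s:{x..t}|lborel. \<bar>f' s\<bar>)"
        using has_ac_derivD[OF f, of x t] t
        by (auto intro!: abs_set_integral_le lf loc_integrable_abs)
      also have "\<dots> \<le> (LINT s:{x..t}|lborel. \<bar>f' s\<bar>) + (LINT s:{t..y}|lborel. \<bar>f' s\<bar>)"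
        by (simp add: set_lebesgue_integral_def)
      also have "\<dots> = N y - N x"
        using set_integral_Icc_split[OF loc_integrable_abs[OF lf], of x t y] t by (simp add: Ndiff)
      finally have "\<bar>f t - f x\<bar> * \<bar>g' t\<bar> \<le> (N y - N x) * K"
        using t xy K K0 by (intro mult_mono) auto
      then show "\<bar>f x * g' t - f t * g' t\<bar> \<le> (N y - N x) * K"
        by (simp add: abs_mult[symmetric] algebra_simps abs_minus_commute)
    qed (intro loc_integrable_diff loc_integrable_cmult lg l2 loc_integrable_continuous continuous_intros)+
    have "\<bar>LINT t:{x..y}|lborel. f' t * g y - f' t * g t\<bar> \<le> K * (y - x) * (N y - N x)"
      using b1 by (simp add: Ndiff)
    moreover have "\<bar>LINT t:{x..y}|lborel. f x * g' t - f t * g' t\<bar> \<le> K * (y - x) * (N y - N x)"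
      using b2 xy(2) by (simp add: set_integral_Icc_const mult_ac)
    ultimately show "\<bar>H y - H x\<bar> \<le> (2 * K) * (y - x) * (N y - N x)"
      using eq by (simp add: mult.assoc)
  qed
  moreover have "(LINT t:{a..a}|lborel. h t) = 0"
    unfolding h_def by (rule set_integral_Icc_refl[OF l])
  ultimately show "f b * g b - f a * g a = (LINT t:{a..b}|lborel. f' t * g t + f t * g' t)"
    by (simp add: H_def h_def)
qed

section \<open>Linear second-order equations\<close>

text \<open>The oriented integral from c to x; the case distinction is there because set integrals
  do not carry a sign, and initial data are posed at an interior point of the line.\<close>

definition primitive :: "real \<Rightarrow> (real \<Rightarrow> real) \<Rightarrow> real \<Rightarrow> real" where
  "primitive c g x = (if c \<le> x then LINT t:{c..x}|lborel. g t else - (LINT t:{x..c}|lborel. g t))"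

lemma primitive_has_ac_deriv:
  assumes g: "loc_integrable g"
  shows "has_ac_deriv (primitive c g) g"
proof (rule has_ac_derivI[OF g])
  fix a b :: real assume "a \<le> b"
  consider "c \<le> a" | "a < c" "c \<le> b" | "b < c" by linarith
  then show "primitive c g b - primitive c g a = (LINT t:{a..b}|lborel. g t)"
  proof cases
    case 1
    then show ?thesis using set_integral_Icc_split[OF g 1 \<open>a \<le> b\<close>] \<open>a \<le> b\<close> by (simp add: primitive_def)
  next
    case 2
    then show ?thesis using set_integral_Icc_split[OF g, of a c b] by (simp add: primitive_def)
  next
    case 3
    then show ?thesis using set_integral_Icc_split[OF g \<open>a \<le> b\<close>, of c] \<open>a \<le> b\<close> by (simp add: primitive_def)
  qed
qed

lemma primitive_self:
  assumes "loc_integrable g"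
  shows "primitive c g c = 0"
  by (simp only: primitive_def set_integral_Icc_refl[OF assms]) simp

lemma primitive_diff:
  assumes "loc_integrable f" "loc_integrable g"
  shows "primitive c f x - primitive c g x = primitive c (\<lambda>t. f t - g t) x"
  using assms by (auto simp: primitive_def set_integral_diff loc_integrableD)

text \<open>Integrating the weight exp (M |t - c|) gains a factor 1 / M. Two integrations gain 1 /
  M^2, which is what makes the integral operator of the second-order equation contract for large
  M.\<close>

lemma primitive_exp_bound:
  assumes g: "loc_integrable g" and M: "M > 0" and bd: "\<And>t. \<bar>g t\<bar> \<le> A * exp (M * \<bar>t - c\<bar>)"
  shows "\<bar>primitive c g x\<bar> \<le> A / M * exp (M * \<bar>x - c\<bar>)"
proof -
  have A: "A \<ge> 0" using bd[of c] by simp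
  \<comment> \<open>The sign s = 1 serves the points right of c and s = -1 those left of it;
    \<open>s * s = 1\<close> cancels the sign produced by differentiation.\<close>
  have E: "has_ac_deriv (\<lambda>t. A / M * s * exp (M * s * (t - c))) (\<lambda>t. A * exp (M * s * (t - c)))" if "s * s = 1" for s
    using M that by (intro DERIV_has_ac_deriv) (auto intro!: derivative_eq_intros continuous_intros simp: mult_ac)
  show ?thesis
  proof (cases "c \<le> x")
    case True
    have "\<bar>LINT t:{c..x}|lborel. g t\<bar> \<le> (LINT t:{c..x}|lborel. A * exp (M * 1 * (t - c)))"
      using bd by (intro abs_set_integral_le g loc_integrable_continuous continuous_intros)
        (metis abs_of_nonneg atLeastAtMost_iff diff_ge_0_iff_ge mult.right_neutral)
    also have "\<dots> = A / M * exp (M * (x - c)) - A / M"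
      using has_ac_derivD[OF E[of 1] True] by simp
    also have "\<dots> \<le> A / M * exp (M * \<bar>x - c\<bar>)" using True A M by simp
    finally show ?thesis using True by (simp add: primitive_def)
  next
    case False
    have "\<bar>LINT t:{x..c}|lborel. g t\<bar> \<le> (LINT t:{x..c}|lborel. A * exp (M * (-1) * (t - c)))"
    proof (intro abs_set_integral_le g loc_integrable_continuous continuous_intros)
      fix t assume "t \<in> {x..c}"
      then show "\<bar>g t\<bar> \<le> A * exp (M * (-1) * (t - c))" using bd[of t] by (simp add: abs_of_nonpos minus_mult_right)
    qed
    also have "\<dots> = A / M * exp (M * (c - x)) - A / M"
      using has_ac_derivD[OF E[of "-1"], of x c] False by (simp add: minus_mult_right)
    also have "\<dots> \<le> A / M * exp (M * \<bar>x - c\<bar>)" using False A M by simp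
    finally show ?thesis using False by (simp add: primitive_def)
  qed
qed

text \<open>The equation y'' = Q y as a first-order system, with no exceptional null set: the
  density of \<open>y1\<close> is taken to be the product \<open>Q x * y x\<close> itself.\<close>

definition sl_solution :: "(real \<Rightarrow> real) \<Rightarrow> (real \<Rightarrow> real) \<Rightarrow> (real \<Rightarrow> real) \<Rightarrow> bool" where
  "sl_solution Q y y1 \<longleftrightarrow> has_ac_deriv y y1 \<and> has_ac_deriv y1 (\<lambda>x. Q x * y x)"

text \<open>Banach's fixed point theorem for the integral equation, in the sup norm with weight
  \<open>exp (- M \<bar>x - c\<bar>)\<close>, where \<open>M\<^sup>2 = B + 1\<close> makes the integral operator a contraction on the whole line.\<close>
theorem sl_solution_exists:
  assumes Q: "Q \<in> borel_measurable lborel" and B: "\<And>x. \<bar>Q x\<bar> \<le> B"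
  shows "\<exists>y y1. sl_solution Q y y1 \<and> y c = p \<and> y1 c = q"
proof -
  have B0: "B \<ge> 0" using B[of 0] by linarith
  define M where "M = sqrt (B + 1)"
  have M: "M > 0" "M * M = B + 1" using B0 by (auto simp: M_def)
  define w where "w x = exp (M * \<bar>x - c\<bar>)" for x
  have w1: "w x \<ge> 1" for x using M by (simp add: w_def)
  have cw: "continuous_on UNIV w" unfolding w_def by (intro continuous_intros)
  \<comment> \<open>The unknown is z = y / w, which stays bounded although y may grow exponentially.
    \<open>S1\<close> and \<open>S0\<close> are the right-hand sides of the integral equations for
    y' and y, written in terms of z.\<close>
  define S1 where "S1 z x = q + primitive c (\<lambda>t. Q t * (w t * z t)) x" for z x
  define S0 where "S0 z x = p + primitive c (S1 z) x" for z x
  have lQ: "loc_integrable (\<lambda>t. Q t * (w t * z t))" if "continuous_on UNIV z" for z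
    by (rule loc_integrable_bounded_mult_continuous[OF Q B]) (intro continuous_intros cw that)
  have ac_const: "has_ac_deriv (\<lambda>x. r + f x) g" if "has_ac_deriv f g" for r :: real and f g
    using that by (simp add: has_ac_deriv_def)
  have ac1: "has_ac_deriv (S1 z) (\<lambda>t. Q t * (w t * z t))" if "continuous_on UNIV z" for z
    unfolding S1_def by (intro ac_const primitive_has_ac_deriv lQ that)
  have ac0: "has_ac_deriv (S0 z) (S1 z)" if "continuous_on UNIV z" for z
    unfolding S0_def by (intro ac_const primitive_has_ac_deriv loc_integrable_continuous has_ac_deriv_continuous[OF ac1] that)
  have S1_bound: "\<bar>S1 z x\<bar> \<le> (\<bar>q\<bar> + B * K / M) * w x" if "continuous_on UNIV z" "\<And>x. \<bar>z x\<bar> \<le> K" for z x K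
  proof -
    have K0: "K \<ge> 0" using that(2)[of 0] by linarith
    have "\<bar>primitive c (\<lambda>t. Q t * (w t * z t)) x\<bar> \<le> B * K / M * exp (M * \<bar>x - c\<bar>)"
    proof (rule primitive_exp_bound[OF lQ[OF that(1)] M(1)])
      fix t
      have "\<bar>Q t\<bar> * (w t * \<bar>z t\<bar>) \<le> B * (w t * K)"
        using B w1[of t] B0 that(2) by (intro mult_mono) (auto intro: mult_nonneg_nonneg)
      then show "\<bar>Q t * (w t * z t)\<bar> \<le> B * K * exp (M * \<bar>t - c\<bar>)"
        using w1[of t] by (simp add: abs_mult w_def mult_ac)
    qed
    moreover have "\<bar>q\<bar> \<le> \<bar>q\<bar> * w x" using w1[of x] by (simp add: mult_le_cancel_left1)
    ultimately show ?thesis by (simp add: S1_def w_def distrib_right)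
  qed
  have S0_bound: "\<bar>S0 z x\<bar> \<le> (\<bar>p\<bar> + (\<bar>q\<bar> + B * K / M) / M) * w x" if "continuous_on UNIV z" "\<And>x. \<bar>z x\<bar> \<le> K" for z x K
  proof -
    have "\<bar>primitive c (S1 z) x\<bar> \<le> (\<bar>q\<bar> + B * K / M) / M * exp (M * \<bar>x - c\<bar>)"
      using S1_bound[OF that]
      by (intro primitive_exp_bound[OF _ M(1)] loc_integrable_continuous has_ac_deriv_continuous[OF ac1] that(1)) (simp add: w_def)
    moreover have "\<bar>p\<bar> \<le> \<bar>p\<bar> * w x" using w1[of x] by (simp add: mult_le_cancel_left1)
    ultimately show ?thesis by (simp only: S0_def w_def distrib_right) linarith
  qed
  have S0_diff: "\<bar>S0 z x - S0 z' x\<bar> \<le> B * K / M / M * w x"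
    if z: "continuous_on UNIV z" and z': "continuous_on UNIV z'" and K: "\<And>x. \<bar>z x - z' x\<bar> \<le> K" for z z' x K
  proof -
    have K0: "K \<ge> 0" using K[of 0] by linarith
    have 1: "\<bar>S1 z t - S1 z' t\<bar> \<le> B * K / M * exp (M * \<bar>t - c\<bar>)" for t
    proof -
      have "S1 z t - S1 z' t = primitive c (\<lambda>t. Q t * (w t * z t) - Q t * (w t * z' t)) t"
        by (simp add: S1_def primitive_diff lQ z z')
      also have "\<bar>\<dots>\<bar> \<le> B * K / M * exp (M * \<bar>t - c\<bar>)"
      proof (rule primitive_exp_bound[OF loc_integrable_diff[OF lQ[OF z] lQ[OF z']] M(1)])
        fix t
        have "\<bar>Q t\<bar> * (w t * \<bar>z t - z' t\<bar>) \<le> B * (w t * K)"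
          using B w1[of t] B0 K by (intro mult_mono) (auto intro: mult_nonneg_nonneg)
        moreover have "Q t * (w t * z t) - Q t * (w t * z' t) = Q t * (w t * (z t - z' t))"
          by (simp add: algebra_simps)
        ultimately show "\<bar>Q t * (w t * z t) - Q t * (w t * z' t)\<bar> \<le> B * K * exp (M * \<bar>t - c\<bar>)"
          using w1[of t] by (simp add: abs_mult w_def mult_ac)
      qed
      finally show ?thesis .
    qed
    have li: "loc_integrable (S1 z)" "loc_integrable (S1 z')"
      using z z' by (auto intro: loc_integrable_continuous has_ac_deriv_continuous[OF ac1])
    have "S0 z x - S0 z' x = primitive c (\<lambda>t. S1 z t - S1 z' t) x"
      by (simp add: S0_def primitive_diff li)
    also have "\<bar>\<dots>\<bar> \<le> B * K / M / M * exp (M * \<bar>x - c\<bar>)"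
      by (rule primitive_exp_bound[OF loc_integrable_diff[OF li] M(1) 1])
    finally show ?thesis by (simp add: w_def)
  qed
  define T where "T f = Bcontfun (\<lambda>x. S0 (apply_bcontfun f) x / w x)" for f :: "real \<Rightarrow>\<^sub>C real"
  have T: "apply_bcontfun (T f) x = S0 (apply_bcontfun f) x / w x" for f x
  proof -
    have c: "continuous_on UNIV (apply_bcontfun f)" by simp
    have "(\<lambda>x. S0 (apply_bcontfun f) x / w x) \<in> bcontfun"
    proof (rule bcontfun_normI)
      show "continuous_on UNIV (\<lambda>x. S0 (apply_bcontfun f) x / w x)"
        by (intro continuous_intros has_ac_deriv_continuous[OF ac0] c cw) (simp add: w_def)
      show "norm (S0 (apply_bcontfun f) x / w x) \<le> \<bar>p\<bar> + (\<bar>q\<bar> + B * norm f / M) / M" for x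
        using S0_bound[OF c, of "norm f" x] norm_bounded[of f] w1[of x] by (simp add: divide_le_eq)
    qed
    then show ?thesis by (simp add: T_def Bcontfun_inverse)
  qed
  \<comment> \<open>The contraction factor B / (B + 1) is B / M^2: the bound B on Q, and one factor
    1 / M for each of the two integrations.\<close>
  have "\<exists>!f. T f = f"
  proof (rule banach_fix_type[of "B / (B + 1)"])
    show "\<forall>f g. dist (T f) (T g) \<le> B / (B + 1) * dist f g"
    proof (intro allI dist_bound)
      fix f g :: "real \<Rightarrow>\<^sub>C real" and x
      have "\<bar>S0 (apply_bcontfun f) x - S0 (apply_bcontfun g) x\<bar> \<le> B * dist f g / M / M * w x"
        using dist_bounded[of f _ g] by (intro S0_diff) (auto simp: dist_real_def)
      then have "\<bar>S0 (apply_bcontfun f) x - S0 (apply_bcontfun g) x\<bar> / w x \<le> B * dist f g / M / M"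
        using w1[of x] by (simp add: divide_le_eq)
      then show "dist (apply_bcontfun (T f) x) (apply_bcontfun (T g) x) \<le> B / (B + 1) * dist f g"
        using w1[of x] M(2) by (simp add: T dist_real_def diff_divide_distrib[symmetric])
    qed
  qed (use B0 in auto)
  then obtain f where f: "T f = f" by blast
  define z where "z = apply_bcontfun f"
  have cz: "continuous_on UNIV z" by (simp add: z_def)
  \<comment> \<open>At the fixed point \<open>S0 z\<close> is the product \<open>w * z\<close> that
    occurs in the density of \<open>S1 z\<close>, so y = \<open>S0 z\<close> satisfies the
    equation.\<close>
  have "S0 z x = w x * z x" for x
    using T[of f x] f w1[of x] by (simp add: z_def field_simps)
  then have "has_ac_deriv (S1 z) (\<lambda>x. Q x * S0 z x)" using ac1[OF cz] by simp
  then have "sl_solution Q (S0 z) (S1 z)" using ac0[OF cz] by (simp add: sl_solution_def)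
  moreover have "S0 z c = p" "S1 z c = q" using lQ[OF cz] ac0[OF cz]
    by (auto simp: S0_def S1_def primitive_self has_ac_deriv_loc_integrable[OF ac0[OF cz]] has_ac_deriv_loc_integrable[OF ac1[OF cz]])
  ultimately show ?thesis by blast
qed

text \<open>The terms f' g' cancel, leaving only the difference of the potentials. In each of the
  products f' g and g' f the first factor is absolutely continuous and the second continuously
  differentiable, as the product rule requires.\<close>

lemma wronskian_has_ac_deriv:
  assumes f: "sl_solution P f f1" and g: "sl_solution Q g g1"
  shows "has_ac_deriv (\<lambda>x. f1 x * g x - f x * g1 x) (\<lambda>x. (P x - Q x) * f x * g x)"
proof -
  have 1: "has_ac_deriv (\<lambda>x. f1 x * g x) (\<lambda>x. P x * f x * g x + f1 x * g1 x)"
    using f g has_ac_deriv_continuous[of g1] by (auto simp: sl_solution_def intro: has_ac_deriv_mult)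
  have 2: "has_ac_deriv (\<lambda>x. g1 x * f x) (\<lambda>x. Q x * g x * f x + g1 x * f1 x)"
    using f g has_ac_deriv_continuous[of f1] by (auto simp: sl_solution_def intro: has_ac_deriv_mult)
  show ?thesis
    using has_ac_deriv_diff[OF 1 2] by (simp add: algebra_simps)
qed

text \<open>The Wronskian with the solution that vanishes at \<open>x\<close> with slope 1 is constant, and it is zero at \<open>c\<close>.\<close>
lemma sl_solution_unique:
  assumes Q: "Q \<in> borel_measurable lborel" "\<And>x. \<bar>Q x\<bar> \<le> B"
    and f: "sl_solution Q f f1" and "f c = 0" "f1 c = 0"
  shows "f x = 0"
proof -
  obtain g g1 where g: "sl_solution Q g g1" "g x = 0" "g1 x = 1"
    using sl_solution_exists[OF Q] by blast
  define W where "W t = f1 t * g t - f t * g1 t" for t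
  have W: "has_ac_deriv W (\<lambda>t. 0)"
    using wronskian_has_ac_deriv[OF f g(1)] by (simp add: W_def[abs_def])
  have "W x = W c"
    using has_ac_derivD[OF W, of x c] has_ac_derivD[OF W, of c x] by (cases "x \<le> c") auto
  then show ?thesis using g assms(4,5) by (simp add: W_def)
qed

section \<open>Stability, and eigenvalues as roots\<close>

lemma gronwall:
  fixes s :: "real \<Rightarrow> real"
  assumes s: "continuous_on UNIV s" and K: "K \<ge> 0" and x: "c \<le> x" "x \<le> d"
    and le: "\<And>t. c \<le> t \<Longrightarrow> t \<le> d \<Longrightarrow> s t \<le> F + K * (LINT r:{c..t}|lborel. s r)"
  shows "s x \<le> F * exp (K * (x - c))"
proof -
  define S where "S = primitive c s"
  have S: "DERIV S t :> s t" for t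
    unfolding S_def by (intro has_ac_deriv_DERIV primitive_has_ac_deriv loc_integrable_continuous s)
  have le': "s t \<le> F + K * S t" if "c \<le> t" "t \<le> d" for t
    using le[OF that] that by (simp add: S_def primitive_def)
  \<comment> \<open>The upper bound for s, multiplied by the decaying integrating factor; the
    hypothesis says exactly that its derivative is nonpositive.\<close>
  define G where "G t = (F + K * S t) * exp (- K * (t - c))" for t
  have "G x \<le> G c"
  proof (rule DERIV_nonpos_imp_nonincreasing[OF x(1)])
    fix t assume t: "c \<le> t" "t \<le> x"
    have "DERIV G t :> K * (s t - (F + K * S t)) * exp (- K * (t - c))"
      unfolding G_def by (auto intro!: derivative_eq_intros S simp: algebra_simps)
    moreover have "K * (s t - (F + K * S t)) * exp (- K * (t - c)) \<le> 0"
      using le'[of t] t x K by (intro mult_nonpos_nonneg mult_nonneg_nonpos) auto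
    ultimately show "\<exists>y. DERIV G t :> y \<and> y \<le> 0" by blast
  qed
  also have "G c = F" by (simp add: G_def S_def primitive_self loc_integrable_continuous s)
  finally have "F + K * S x \<le> F * exp (K * (x - c))"
    by (simp add: G_def exp_minus divide_le_eq flip: divide_inverse)
  then show ?thesis using le'[OF x] by linarith
qed

lemma sl_solution_continuous:
  assumes "sl_solution Q f f1"
  shows "continuous_on UNIV f" "continuous_on UNIV f1"
  using assms has_ac_deriv_continuous by (auto simp: sl_solution_def)

text \<open>Writing P f - Q g = P (f - g) + (P - Q) g puts the perturbation of the potential on g
  alone. Only the reference solution g needs an a priori bound, so the estimate is uniform over all
  f. Gronwall is applied to |f - g| + |f' - g'|; the 1 in the rate 1 + B comes from (f - g)' = f' -
  g'.\<close>

lemma sl_solution_perturb: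
  assumes f: "sl_solution P f f1" and g: "sl_solution Q g g1" and fg: "f c = g c"
    and x: "c \<le> x" "x \<le> d" and B: "B \<ge> 0"
    and P: "\<And>t. c \<le> t \<Longrightarrow> t \<le> d \<Longrightarrow> \<bar>P t\<bar> \<le> B"
    and PQ: "\<And>t. c \<le> t \<Longrightarrow> t \<le> d \<Longrightarrow> \<bar>P t - Q t\<bar> \<le> \<epsilon>"
    and G: "\<And>t. c \<le> t \<Longrightarrow> t \<le> d \<Longrightarrow> \<bar>g t\<bar> \<le> G"
  shows "\<bar>f x - g x\<bar> + \<bar>f1 x - g1 x\<bar> \<le> (\<bar>f1 c - g1 c\<bar> + (d - c) * (\<epsilon> * G)) * exp ((1 + B) * (d - c))"
proof -
  have cd: "c \<le> d" using x by linarith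
  have \<epsilon>: "\<epsilon> \<ge> 0" and G0: "G \<ge> 0" using PQ[of c] G[of c] cd by auto
  define F where "F = \<bar>f1 c - g1 c\<bar> + (d - c) * (\<epsilon> * G)"
  have F0: "F \<ge> 0" using cd \<epsilon> G0 by (simp add: F_def)
  define s where "s t = \<bar>f t - g t\<bar> + \<bar>f1 t - g1 t\<bar>" for t
  note cont = sl_solution_continuous[OF f] sl_solution_continuous[OF g]
  have cs: "continuous_on UNIV s" unfolding s_def by (intro continuous_intros cont)
  have lP: "loc_integrable (\<lambda>t. P t * f t)" "loc_integrable (\<lambda>t. Q t * g t)"
    using f g by (auto simp: sl_solution_def dest: has_ac_deriv_loc_integrable)
  have d0: "has_ac_deriv (\<lambda>t. f t - g t) (\<lambda>t. f1 t - g1 t)"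
   and d1: "has_ac_deriv (\<lambda>t. f1 t - g1 t) (\<lambda>t. P t * f t - Q t * g t)"
    using f g by (auto simp: sl_solution_def intro: has_ac_deriv_diff)
  have "s x \<le> F * exp ((1 + B) * (x - c))"
  proof (rule gronwall[OF cs _ x])
    fix t assume t: "c \<le> t" "t \<le> d"
    have c1: "loc_integrable (\<lambda>r. \<bar>f1 r - g1 r\<bar>)" and c2: "loc_integrable (\<lambda>r. B * \<bar>f r - g r\<bar> + \<epsilon> * G)"
      and c3: "loc_integrable (\<lambda>r. (1 + B) * s r)" and c4: "loc_integrable (\<lambda>r. \<epsilon> * G)"
      by (intro loc_integrable_continuous continuous_intros cont cs)+
    have "\<bar>f t - g t\<bar> \<le> (LINT r:{c..t}|lborel. \<bar>f1 r - g1 r\<bar>)"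
      using has_ac_derivD[OF d0 t(1)] fg
      by (auto intro!: abs_set_integral_le c1 loc_integrable_continuous continuous_intros cont)
    moreover have "\<bar>LINT r:{c..t}|lborel. P r * f r - Q r * g r\<bar> \<le> (LINT r:{c..t}|lborel. B * \<bar>f r - g r\<bar> + \<epsilon> * G)"
    proof (intro abs_set_integral_le c2 loc_integrable_diff lP)
      fix r assume r: "r \<in> {c..t}"
      have "P r * f r - Q r * g r = P r * (f r - g r) + (P r - Q r) * g r" by (simp add: algebra_simps)
      then have "\<bar>P r * f r - Q r * g r\<bar> \<le> \<bar>P r\<bar> * \<bar>f r - g r\<bar> + \<bar>P r - Q r\<bar> * \<bar>g r\<bar>"
        by (metis abs_mult abs_triangle_ineq)
      also have "\<dots> \<le> B * \<bar>f r - g r\<bar> + \<epsilon> * G"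
        using r t P[of r] PQ[of r] G[of r] \<epsilon> by (intro add_mono mult_mono) auto
      finally show "\<bar>P r * f r - Q r * g r\<bar> \<le> B * \<bar>f r - g r\<bar> + \<epsilon> * G" .
    qed
    ultimately have "s t \<le> \<bar>f1 c - g1 c\<bar> + ((LINT r:{c..t}|lborel. \<bar>f1 r - g1 r\<bar>) + (LINT r:{c..t}|lborel. B * \<bar>f r - g r\<bar> + \<epsilon> * G))"
      using has_ac_derivD[OF d1 t(1)] by (simp add: s_def)
    also have "(LINT r:{c..t}|lborel. \<bar>f1 r - g1 r\<bar>) + (LINT r:{c..t}|lborel. B * \<bar>f r - g r\<bar> + \<epsilon> * G)
       = (LINT r:{c..t}|lborel. \<bar>f1 r - g1 r\<bar> + (B * \<bar>f r - g r\<bar> + \<epsilon> * G))"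
      by (intro set_integral_add(2)[symmetric] loc_integrableD c1 c2)
    also have "\<dots> \<le> (LINT r:{c..t}|lborel. (1 + B) * s r + \<epsilon> * G)"
    proof (intro set_integral_mono loc_integrableD loc_integrable_add[OF c1 c2] loc_integrable_add[OF c3 c4])
      fix r
      have "(1 + B) * s r = \<bar>f r - g r\<bar> + \<bar>f1 r - g1 r\<bar> + B * \<bar>f r - g r\<bar> + B * \<bar>f1 r - g1 r\<bar>"
        by (simp add: s_def algebra_simps)
      then show "\<bar>f1 r - g1 r\<bar> + (B * \<bar>f r - g r\<bar> + \<epsilon> * G) \<le> (1 + B) * s r + \<epsilon> * G"
        using B by simp
    qed
    also have "\<dots> = (1 + B) * (LINT r:{c..t}|lborel. s r) + \<epsilon> * G * (t - c)"
      using set_integral_add(2)[OF loc_integrableD[OF c3, of c t] loc_integrableD[OF c4, of c t]] t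
      by (simp only: set_integral_Icc_const set_integral_mult_right)
    also have "\<epsilon> * G * (t - c) \<le> (d - c) * (\<epsilon> * G)"
      using t \<epsilon> G0 by (subst mult.commute) (intro mult_right_mono, auto)
    finally show "s t \<le> F + (1 + B) * (LINT r:{c..t}|lborel. s r)" by (simp add: F_def)
  qed (use B in auto)
  also have "\<dots> \<le> F * exp ((1 + B) * (d - c))"
    using F0 B x by (intro mult_left_mono) (auto intro: mult_left_mono)
  finally show ?thesis by (simp add: s_def F_def)
qed

text \<open>After multiplication by the integrating factor exp (-\<kappa> (t - a)) the density
  vanishes on the interval, so the product takes equal values at both ends.\<close>

lemma has_ac_deriv_exponential:
  fixes p :: "real \<Rightarrow> real"
  assumes p: "has_ac_deriv p p'" and "a \<le> b" and eq: "\<And>t. a \<le> t \<Longrightarrow> t \<le> b \<Longrightarrow> p' t = \<kappa> * p t"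
  shows "p b = p a * exp (\<kappa> * (b - a))"
proof -
  have e: "has_ac_deriv (\<lambda>t. exp (- \<kappa> * (t - a))) (\<lambda>t. - \<kappa> * exp (- \<kappa> * (t - a)))"
    by (intro DERIV_has_ac_deriv) (auto intro!: derivative_eq_intros continuous_intros)
  have "p b * exp (- \<kappa> * (b - a)) - p a * exp (- \<kappa> * (a - a)) =
    (LINT t:{a..b}|lborel. p' t * exp (- \<kappa> * (t - a)) + p t * (- \<kappa> * exp (- \<kappa> * (t - a))))"
    by (intro has_ac_derivD[OF has_ac_deriv_mult[OF p e]] \<open>a \<le> b\<close>) (intro continuous_intros)
  also have "\<dots> = (LINT t:{a..b}|lborel. 0)"
    by (rule set_lebesgue_integral_cong) (auto simp: eq)
  finally have "p b * exp (- \<kappa> * (b - a)) = p a" by simp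
  then show ?thesis by (auto simp: exp_minus divide_eq_eq simp flip: divide_inverse)
qed

text \<open>The operator d^2/dx^2 - k^2 factors, so f' + k f solves a first-order equation with rate
  k. This quantity is the amplitude of the growing exponential, and its vanishing at R is the decay
  condition. With k = 0 the lemma says that f' is constant.\<close>

lemma sl_solution_right:
  assumes f: "sl_solution Q f f1" and Q: "\<And>t. t \<ge> R \<Longrightarrow> Q t = k\<^sup>2" and x: "x \<ge> R"
  shows "f1 x + k * f x = (f1 R + k * f R) * exp (k * (x - R))"
  using f has_ac_deriv_exponential[OF has_ac_deriv_add[OF _ has_ac_deriv_cmult], of f1 _ f f1 R x k k] Q x
  by (auto simp: sl_solution_def algebra_simps power2_eq_square)

lemma sl_solution_left:
  assumes f: "sl_solution Q f f1" and Q: "\<And>t. t \<le> L \<Longrightarrow> Q t = k\<^sup>2" and x: "x \<le> L"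
  shows "f1 x - k * f x = (f1 L - k * f L) * exp (k * (L - x))"
proof -
  have "f1 L + (- k) * f L = (f1 x + (- k) * f x) * exp (- k * (L - x))"
    using f has_ac_deriv_exponential[OF has_ac_deriv_add[OF _ has_ac_deriv_cmult], of f1 _ f f1 x L "-k" "-k"] Q x
    by (auto simp: sl_solution_def algebra_simps power2_eq_square)
  then show ?thesis by (auto simp: exp_minus divide_eq_eq simp flip: divide_inverse)
qed

section \<open>Eigenfunctions and decaying real solutions\<close>

lemma has_ac_deriv_bounded_linear:
  assumes T: "bounded_linear T" and f: "has_ac_deriv f g"
  shows "has_ac_deriv (\<lambda>x. T (f x)) (\<lambda>x. T (g x))"
proof -
  interpret bounded_linear T by fact
  show ?thesis
    unfolding has_ac_deriv_def
  proof (intro allI impI)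
    fix a b :: real assume "a \<le> b"
    then have i: "integrable lborel (\<lambda>x. indicator {a..b} x *\<^sub>R g x)"
      and e: "f b - f a = (\<integral>x. indicator {a..b} x *\<^sub>R g x \<partial>lborel)"
      using f by (auto simp: has_ac_deriv_def set_integrable_def set_lebesgue_integral_def)
    have "(\<integral>x. T (indicator {a..b} x *\<^sub>R g x) \<partial>lborel) = T (f b - f a)"
      using integral_bounded_linear[OF T i] e by simp
    then show "set_integrable lborel {a..b} (\<lambda>x. T (g x)) \<and> T (f b) - T (f a) = (LINT t:{a..b}|lborel. T (g t))"
      using integrable_bounded_linear[OF T i]
      by (simp add: set_integrable_def set_lebesgue_integral_def scaleR diff)
  qed
qed

text \<open>An interval of length n contributes at least n e to a finite integral. This excludes a
  growing exponential: its square stays above its boundary value on a whole half-line.\<close>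

lemma integrable_lower_bound_long_intervals:
  fixes h :: "real \<Rightarrow> real"
  assumes h: "integrable lborel h" "\<And>x. h x \<ge> 0"
    and long: "\<And>n::nat. \<exists>a. \<forall>x\<in>{a..a + real n}. e \<le> h x"
  shows "e \<le> 0"
proof (rule ccontr)
  assume "\<not> e \<le> 0"
  then have e: "e > 0" by simp
  obtain n :: nat where n: "(\<integral>x. h x \<partial>lborel) < real n * e"
    using reals_Archimedean3[OF e] by blast
  obtain a where a: "\<forall>x\<in>{a..a + real n}. e \<le> h x" using long by blast
  have "real n * e = (\<integral>x. indicator {a..a + real n} x *\<^sub>R e \<partial>lborel)"
    by simp
  also have "\<dots> \<le> (\<integral>x. h x \<partial>lborel)"
  proof (rule integral_mono[OF _ h(1)])
    show "integrable lborel (\<lambda>x. indicator {a..a + real n} x *\<^sub>R e)" by simp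
  qed (use a h(2) in \<open>auto simp: indicator_def\<close>)
  finally show False using n by simp
qed

lemma integrable_square_add:
  fixes f g :: "real \<Rightarrow> real"
  assumes "f \<in> borel_measurable lborel" "g \<in> borel_measurable lborel"
    "integrable lborel (\<lambda>x. (f x)\<^sup>2)" "integrable lborel (\<lambda>x. (g x)\<^sup>2)"
  shows "integrable lborel (\<lambda>x. (f x + k * g x)\<^sup>2)"
proof (rule Bochner_Integration.integrable_bound)
  show "integrable lborel (\<lambda>x. 2 * (f x)\<^sup>2 + (2 * k\<^sup>2) * (g x)\<^sup>2)"
    using assms by (intro Bochner_Integration.integrable_add integrable_mult_right) auto
  show "(\<lambda>x. (f x + k * g x)\<^sup>2) \<in> borel_measurable lborel" using assms by measurable
  have "(u + k * v)\<^sup>2 \<le> 2 * u\<^sup>2 + (2 * k\<^sup>2) * v\<^sup>2" for u v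
    using zero_le_power2[of "u - k * v"] by (simp add: power2_eq_square algebra_simps)
  then show "AE x in lborel. norm ((f x + k * g x)\<^sup>2) \<le> norm (2 * (f x)\<^sup>2 + (2 * k\<^sup>2) * (g x)\<^sup>2)"
    by (simp add: order_trans[OF _ abs_ge_self])
qed

lemma eigenvalue_imp_solution:
  assumes ev: "schr_eigenvalue W (- (k\<^sup>2))" and k: "k > 0"
    and W: "W \<in> borel_measurable lborel" "\<And>x. \<bar>W x\<bar> \<le> B"
    and supp: "\<And>x. \<bar>x\<bar> \<ge> R \<Longrightarrow> W x = 0" and R: "R \<ge> 0"
  shows "\<exists>f f1. sl_solution (\<lambda>x. W x + k\<^sup>2) f f1 \<and> f (-R) = 1 \<and> f1 (-R) = k \<and> f1 R + k * f R = 0"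
proof -
  obtain psi psi1 psi2 x0 where psi: "has_ac_deriv psi psi1" "has_ac_deriv psi1 psi2"
      "sq_integrable psi" "sq_integrable psi1" and x0: "psi x0 \<noteq> 0"
    and eq: "AE x in lborel. - psi2 x + complex_of_real (W x) * psi x = complex_of_real (- (k\<^sup>2)) * psi x"
    using ev unfolding schr_eigenvalue_def in_W22_def by blast
  \<comment> \<open>The coefficients are real, so the real and the imaginary part of psi both solve
    the equation; T is one of the two that does not vanish at \<open>x0\<close>.\<close>
  obtain T :: "complex \<Rightarrow> real" where T: "bounded_linear T" and T0: "T (psi x0) \<noteq> 0"
    using x0 bounded_linear_Re bounded_linear_Im complex_eqI[of "psi x0" 0] by auto
  interpret T: bounded_linear T by fact
  define Q where "Q x = W x + k\<^sup>2" for x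
  define g where "g x = T (psi x)" for x
  define g1 where "g1 x = T (psi1 x)" for x
  have Q: "Q \<in> borel_measurable lborel" "\<And>x. \<bar>Q x\<bar> \<le> B + k\<^sup>2"
    using W by (auto simp: Q_def[abs_def] intro!: order_trans[OF abs_triangle_ineq])
  have g: "has_ac_deriv g g1" unfolding g_def g1_def by (rule has_ac_deriv_bounded_linear[OF T psi(1)])
  have "has_ac_deriv g1 (\<lambda>x. T (psi2 x))" unfolding g1_def by (rule has_ac_deriv_bounded_linear[OF T psi(2)])
  moreover have "AE x in lborel. T (psi2 x) = Q x * g x"
    using eq
  proof (rule AE_mp, intro AE_I2 impI)
    fix x assume "- psi2 x + complex_of_real (W x) * psi x = complex_of_real (- (k\<^sup>2)) * psi x"
    then have "psi2 x = Q x *\<^sub>R psi x"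
      by (simp add: Q_def scaleR_conv_of_real algebra_simps add_eq_0_iff)
    then show "T (psi2 x) = Q x * g x" by (simp add: T.scaleR g_def)
  qed
  ultimately have g1: "has_ac_deriv g1 (\<lambda>x. Q x * g x)"
    using loc_integrable_bounded_mult_continuous[OF Q has_ac_deriv_continuous[OF g]]
    by (blast intro: has_ac_deriv_cong_AE)
  have sol: "sl_solution Q g g1" using g g1 by (simp add: sl_solution_def)
  note cont = sl_solution_continuous[OF sol]
  have meas: "g \<in> borel_measurable lborel" "g1 \<in> borel_measurable lborel"
    using cont by (auto intro: borel_measurable_continuous_onI)
  have sq: "integrable lborel (\<lambda>x. (T (h x))\<^sup>2)" if "sq_integrable h" "(\<lambda>x. T (h x)) \<in> borel_measurable lborel" for h
  proof -
    obtain K where K: "\<And>z. norm (T z) \<le> norm z * K" using T.bounded by blast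
    have "integrable lborel (\<lambda>x. (norm (h x))\<^sup>2 * K\<^sup>2)"
      using that by (simp add: sq_integrable_def)
    then show ?thesis
    proof (rule Bochner_Integration.integrable_bound)
      show "AE x in lborel. norm ((T (h x))\<^sup>2) \<le> norm ((norm (h x))\<^sup>2 * K\<^sup>2)"
      proof (intro AE_I2)
        fix x
        show "norm ((T (h x))\<^sup>2) \<le> norm ((norm (h x))\<^sup>2 * K\<^sup>2)"
          using power_mono[OF K[of "h x"], of 2] by (simp add: power_mult_distrib)
      qed
    qed (use that in measurable)
  qed
  have sq2: "integrable lborel (\<lambda>x. (g x)\<^sup>2)" "integrable lborel (\<lambda>x. (g1 x)\<^sup>2)"
    using sq[OF psi(3)] sq[OF psi(4)] meas unfolding g_def g1_def by auto
  \<comment> \<open>The square of g' + k g is integrable, but to the right of R it never falls below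
    its value at R; so that value is 0.\<close>
  have right: "g1 R + k * g R = 0"
  proof -
    have "(g1 R + k * g R)\<^sup>2 \<le> 0"
    proof (rule integrable_lower_bound_long_intervals[OF integrable_square_add[OF meas(2,1) sq2(2,1), of k]])
      fix n :: nat
      have "(g1 R + k * g R)\<^sup>2 \<le> (g1 x + k * g x)\<^sup>2" if "x \<ge> R" for x
      proof -
        have "g1 x + k * g x = (g1 R + k * g R) * exp (k * (x - R))"
          using R supp that by (intro sl_solution_right[OF sol]) (auto simp: Q_def)
        moreover have "1 \<le> exp (k * (x - R))" using k that by simp
        ultimately show ?thesis
          by (simp add: power_mult_distrib mult_le_cancel_left1)
      qed
      then show "\<exists>a. \<forall>x\<in>{a..a + real n}. (g1 R + k * g R)\<^sup>2 \<le> (g1 x + k * g x)\<^sup>2"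
        by (intro exI[of _ R]) auto
    qed simp
    then show ?thesis by simp
  qed
  have left: "g1 (-R) - k * g (-R) = 0"
  proof -
    have "(g1 (-R) + (-k) * g (-R))\<^sup>2 \<le> 0"
    proof (rule integrable_lower_bound_long_intervals[OF integrable_square_add[OF meas(2,1) sq2(2,1), of "-k"]])
      fix n :: nat
      have "(g1 (-R) + (-k) * g (-R))\<^sup>2 \<le> (g1 x + (-k) * g x)\<^sup>2" if "x \<le> -R" for x
      proof -
        have "g1 x - k * g x = (g1 (-R) - k * g (-R)) * exp (k * (-R - x))"
          using R supp that by (intro sl_solution_left[OF sol]) (auto simp: Q_def)
        moreover have "1 \<le> exp (k * (-R - x))" using k that by simp
        ultimately show ?thesis
          by (simp add: power_mult_distrib mult_le_cancel_left1)
      qed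
      then show "\<exists>a. \<forall>x\<in>{a..a + real n}. (g1 (-R) + (-k) * g (-R))\<^sup>2 \<le> (g1 x + (-k) * g x)\<^sup>2"
        by (intro exI[of _ "-R - real n"]) auto
    qed simp
    then show ?thesis by simp
  qed
  \<comment> \<open>Otherwise the decay condition on the left would also give g' (-R) = 0, and
    uniqueness would make g vanish at \<open>x0\<close>. Hence g can be normalized at -R.\<close>
  have gR: "g (-R) \<noteq> 0"
    using sl_solution_unique[OF Q sol, of "-R" x0] left T0 by (auto simp: g_def)
  define r where "r = inverse (g (-R))"
  have "sl_solution Q (\<lambda>x. r * g x) (\<lambda>x. r * g1 x)"
    using has_ac_deriv_cmult[OF g, of r] has_ac_deriv_cmult[OF g1, of r] by (simp add: sl_solution_def mult_ac)
  moreover have "r * g (-R) = 1" "r * g1 (-R) = k" using left gR by (auto simp: r_def)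
  moreover have "r * g1 R + k * (r * g R) = r * (g1 R + k * g R)" by (simp add: algebra_simps)
  ultimately show ?thesis using right unfolding Q_def by (metis mult_zero_right)
qed

lemma set_integrable_exp_right:
  fixes b R :: real
  assumes "b > 0"
  shows "set_integrable lborel {R..} (\<lambda>x. exp (- b * x))"
proof -
  have "(\<lambda>x. exp (- b * x)) absolutely_integrable_on {R..}"
    using assms by (intro nonnegative_absolutely_integrable_1 integrable_on_exp_minus_to_infinity) auto
  then have "integrable lebesgue (\<lambda>x. indicator {R..} x *\<^sub>R exp (- b * x))"
    by (simp add: set_integrable_def)
  then show ?thesis
    unfolding set_integrable_def by (subst (asm) integrable_completion) auto
qed

lemma integrable_square_exp_tails:
  fixes f :: "real \<Rightarrow> real"
  assumes f: "continuous_on UNIV f" and k: "k > 0"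
    and right: "\<And>x. x \<ge> R \<Longrightarrow> f x = A * exp (- k * x)"
    and left: "\<And>x. x \<le> L \<Longrightarrow> f x = B * exp (k * x)"
  shows "integrable lborel (\<lambda>x. (f x)\<^sup>2)"
proof -
  have e: "(A * exp (s * x))\<^sup>2 = A\<^sup>2 * exp (2 * s * x)" for A s x :: real
    by (simp add: power_mult_distrib exp_double[symmetric] mult.assoc)
  have "set_integrable lborel {R..} (\<lambda>x. A\<^sup>2 * exp (- (2 * k) * x))"
    using k by (intro set_integrable_mult_right set_integrable_exp_right) simp
  then have 1: "set_integrable lborel {R..} (\<lambda>x. (f x)\<^sup>2)"
    by (rule set_integrable_cong[THEN iffD1, rotated -1]) (use right e[of A "-k"] in auto)
  have "set_integrable lborel {-L..} (\<lambda>x. B\<^sup>2 * exp (- (2 * k) * x))"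
    using k by (intro set_integrable_mult_right set_integrable_exp_right) simp
  \<comment> \<open>The reflection x -> -x reduces the left tail to the right one.\<close>
  then have "integrable lborel (\<lambda>x. indicator {-L..} (0 + (-1) * x) *\<^sub>R (B\<^sup>2 * exp (- (2 * k) * (0 + (-1) * x))))"
    unfolding set_integrable_def by (rule lborel_integrable_real_affine) simp
  then have "set_integrable lborel {..L} (\<lambda>x. B\<^sup>2 * exp (2 * k * x))"
    unfolding set_integrable_def by (rule Bochner_Integration.integrable_cong[THEN iffD1, rotated -1])
      (auto simp: indicator_def)
  then have 2: "set_integrable lborel {..L} (\<lambda>x. (f x)\<^sup>2)"
    by (rule set_integrable_cong[THEN iffD1, rotated -1]) (use left e[of B k] in auto)
  have 3: "set_integrable lborel {L..R} (\<lambda>x. (f x)\<^sup>2)"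
    by (intro borel_integrable_atLeastAtMost' continuous_intros continuous_on_subset[OF f]) auto
  have "set_integrable lborel (({..L} \<union> {L..R}) \<union> {R..}) (\<lambda>x. (f x)\<^sup>2)"
    by (intro set_integrable_Un 1 2 3) auto
  moreover have "({..L} \<union> {L..R}) \<union> {R..} = UNIV" by auto
  ultimately show ?thesis by (simp add: set_integrable_def)
qed

text \<open>The relations at -R and R remove the growing exponential on either side, so f and f' are
  pure decaying exponentials outside [-R, R], hence square integrable; the second derivative follows
  because the potential is bounded.\<close>

lemma solution_imp_eigenvalue:
  assumes sol: "sl_solution (\<lambda>x. W x + k\<^sup>2) f f1" and "f (-R) = 1" "f1 (-R) = k" "f1 R + k * f R = 0"
    and k: "k > 0" and W: "W \<in> borel_measurable lborel" "\<And>x. \<bar>W x\<bar> \<le> B"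
    and supp: "\<And>x. \<bar>x\<bar> \<ge> R \<Longrightarrow> W x = 0" and R: "R \<ge> 0"
  shows "schr_eigenvalue W (- (k\<^sup>2))"
proof -
  define Q where "Q x = W x + k\<^sup>2" for x
  have Q: "Q \<in> borel_measurable lborel" "\<And>x. \<bar>Q x\<bar> \<le> B + k\<^sup>2"
    using W by (auto simp: Q_def[abs_def] intro!: order_trans[OF abs_triangle_ineq])
  have ac: "has_ac_deriv f f1" "has_ac_deriv f1 (\<lambda>x. Q x * f x)"
    using sol by (auto simp: sl_solution_def Q_def)
  note cont = sl_solution_continuous[OF sol]
  have r1: "f1 x = - k * f x" if "x \<ge> R" for x
    using sl_solution_right[OF sol, of R k x] supp R that assms(4) by auto
  have l1: "f1 x = k * f x" if "x \<le> - R" for x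
    using sl_solution_left[OF sol, of "-R" k x] supp R that assms(2,3) by auto
  have r0: "f x = (f R * exp (k * R)) * exp (- k * x)" if "x \<ge> R" for x
    using has_ac_deriv_exponential[OF ac(1) that, of "-k"] r1
    by (simp add: exp_add[symmetric] algebra_simps)
  have l0: "f x = exp (k * R) * exp (k * x)" if "x \<le> - R" for x
    using has_ac_deriv_exponential[OF ac(1) that, of k] l1 assms(2)
    by (simp add: exp_add exp_minus exp_diff field_simps)
  have i0: "integrable lborel (\<lambda>x. (f x)\<^sup>2)"
    by (rule integrable_square_exp_tails[OF cont(1) k r0 l0])
  have i1: "integrable lborel (\<lambda>x. (f1 x)\<^sup>2)"
  proof (rule integrable_square_exp_tails[OF cont(2) k])
    show "f1 x = (- k * (f R * exp (k * R))) * exp (- k * x)" if "x \<ge> R" for x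
      using r1[OF that] r0[OF that] by simp
    show "f1 x = (k * exp (k * R)) * exp (k * x)" if "x \<le> -R" for x
      using l1[OF that] l0[OF that] by simp
  qed
  have meas: "f \<in> borel_measurable lborel" "f1 \<in> borel_measurable lborel"
    using cont by (auto intro: borel_measurable_continuous_onI)
  have i2: "integrable lborel (\<lambda>x. (Q x * f x)\<^sup>2)"
  proof (rule Bochner_Integration.integrable_bound)
    show "integrable lborel (\<lambda>x. (B + k\<^sup>2)\<^sup>2 * (f x)\<^sup>2)" using i0 by simp
    show "(\<lambda>x. (Q x * f x)\<^sup>2) \<in> borel_measurable lborel" using meas Q by measurable
    have "(Q x)\<^sup>2 \<le> (B + k\<^sup>2)\<^sup>2" for x
      using power_mono[OF Q(2), of x 2] by simp
    then show "AE x in lborel. norm ((Q x * f x)\<^sup>2) \<le> norm ((B + k\<^sup>2)\<^sup>2 * (f x)\<^sup>2)"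
      by (simp add: power_mult_distrib mult_right_mono)
  qed
  let ?c = complex_of_real
  have "in_W22 (\<lambda>x. ?c (f x)) (\<lambda>x. ?c (Q x * f x))"
    unfolding in_W22_def
  proof (intro exI conjI)
    show "has_ac_deriv (\<lambda>x. ?c (f x)) (\<lambda>x. ?c (f1 x))" "has_ac_deriv (\<lambda>x. ?c (f1 x)) (\<lambda>x. ?c (Q x * f x))"
      by (rule has_ac_deriv_bounded_linear[OF bounded_linear_of_real] ac)+
    show "sq_integrable (\<lambda>x. ?c (f x))" "sq_integrable (\<lambda>x. ?c (f1 x))" "sq_integrable (\<lambda>x. ?c (Q x * f x))"
      using i0 i1 i2 meas Q by (auto simp: sq_integrable_def norm_mult power_mult_distrib)
  qed
  moreover have "?c (f (-R)) \<noteq> 0" using assms(2) by simp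
  moreover have "- ?c (Q x * f x) + ?c (W x) * ?c (f x) = ?c (- (k\<^sup>2)) * ?c (f x)" for x
    by (simp add: Q_def algebra_simps)
  ultimately show ?thesis
    unfolding schr_eigenvalue_def
    by (intro exI[of _ "\<lambda>x. ?c (f x)"] exI[of _ "\<lambda>x. ?c (Q x * f x)"]) auto
qed

section \<open>The characteristic function near a resonance\<close>

lemma half_bound_state_solution:
  assumes U: "U \<in> borel_measurable lborel" "\<And>x. \<bar>U x\<bar> \<le> B" and u: "half_bound_state U u"
  shows "\<exists>u1. sl_solution U u u1"
proof -
  obtain h1 h2 where h: "has_ac_deriv u h1" "has_ac_deriv h1 h2" "AE x in lborel. - h2 x + U x * u x = 0"
    using u unfolding half_bound_state_def by blast
  have "AE x in lborel. h2 x = U x * u x"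
    using h(3) by (rule AE_mp) (intro AE_I2 impI, linarith)
  then have "has_ac_deriv h1 (\<lambda>x. U x * u x)"
    using loc_integrable_bounded_mult_continuous[OF U has_ac_deriv_continuous[OF h(1)]] h(2)
    by (blast intro: has_ac_deriv_cong_AE)
  then show ?thesis using h(1) by (auto simp: sl_solution_def)
qed

text \<open>Outside the support the solution is affine. A finite limit makes the increments u (x +
  1) - u x tend to 0, so the slope is 0 and the limit is already attained at R.\<close>

lemma sl_solution_const_right:
  assumes u: "sl_solution U u u1" and U: "\<And>t. t \<ge> R \<Longrightarrow> U t = 0" and lim: "(u \<longlongrightarrow> \<theta>) at_top"
  shows "u1 R = 0" "u R = \<theta>"
proof -
  have c: "u1 x = u1 R" if "x \<ge> R" for x
    using sl_solution_right[OF u, of R 0 x] U that by simp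
  have d: "u y - u x = u1 R * (y - x)" if "R \<le> x" "x \<le> y" for x y
  proof -
    have "u y - u x = (LINT t:{x..y}|lborel. u1 t)"
      using u that by (intro has_ac_derivD[of u u1 x y]) (simp_all add: sl_solution_def)
    also have "\<dots> = (LINT t:{x..y}|lborel. u1 R)"
      using that by (intro set_lebesgue_integral_cong) (auto intro: c)
    finally show ?thesis using that by (simp add: set_integral_Icc_const)
  qed
  have "((\<lambda>x. u (x + 1) - u x) \<longlongrightarrow> \<theta> - \<theta>) at_top"
  proof (intro tendsto_diff lim filterlim_compose[OF lim])
    show "filterlim (\<lambda>x::real. x + 1) at_top at_top"
      unfolding filterlim_at_top
    proof
      fix Z :: real
      show "\<forall>\<^sub>F x in at_top. Z \<le> x + 1"
        using eventually_ge_at_top[of Z] by eventually_elim simp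
    qed
  qed
  moreover have "\<forall>\<^sub>F x in at_top. u (x + 1) - u x = u1 R"
    using eventually_ge_at_top[of R] by eventually_elim (simp add: d)
  ultimately have "((\<lambda>x::real. u1 R) \<longlongrightarrow> 0) at_top"
    by (simp add: tendsto_cong)
  then show 0: "u1 R = 0" by (simp add: tendsto_const_iff)
  have "\<forall>\<^sub>F x in at_top. u x = u R"
    using eventually_ge_at_top[of R]
  proof eventually_elim
    case (elim x)
    then show ?case using d[of R x] 0 by simp
  qed
  then have "((\<lambda>x::real. u R) \<longlongrightarrow> \<theta>) at_top" using lim by (simp add: tendsto_cong)
  then show "u R = \<theta>" by (simp add: tendsto_const_iff)
qed

lemma sl_solution_const_left:
  assumes u: "sl_solution U u u1" and U: "\<And>t. t \<le> L \<Longrightarrow> U t = 0" and lim: "(u \<longlongrightarrow> \<theta>) at_bot"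
  shows "u1 L = 0" "u L = \<theta>"
proof -
  have c: "u1 x = u1 L" if "x \<le> L" for x
    using sl_solution_left[OF u, of L 0 x] U that by simp
  have d: "u y - u x = u1 L * (y - x)" if "x \<le> y" "y \<le> L" for x y
  proof -
    have "u y - u x = (LINT t:{x..y}|lborel. u1 t)"
      using u that by (intro has_ac_derivD[of u u1 x y]) (simp_all add: sl_solution_def)
    also have "\<dots> = (LINT t:{x..y}|lborel. u1 L)"
      using that by (intro set_lebesgue_integral_cong) (auto intro: c)
    finally show ?thesis using that by (simp add: set_integral_Icc_const)
  qed
  have "((\<lambda>x. u x - u (x - 1)) \<longlongrightarrow> \<theta> - \<theta>) at_bot"
  proof (intro tendsto_diff lim filterlim_compose[OF lim])
    show "filterlim (\<lambda>x::real. x - 1) at_bot at_bot"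
      unfolding filterlim_at_bot
    proof
      fix Z :: real
      show "\<forall>\<^sub>F x in at_bot. x - 1 \<le> Z"
        using eventually_le_at_bot[of Z] by eventually_elim simp
    qed
  qed
  moreover have "\<forall>\<^sub>F x in at_bot. u x - u (x - 1) = u1 L"
    using eventually_le_at_bot[of L] by eventually_elim (simp add: d)
  ultimately have "((\<lambda>x::real. u1 L) \<longlongrightarrow> 0) at_bot"
    by (simp add: tendsto_cong)
  then show 0: "u1 L = 0" by (simp add: tendsto_const_iff)
  have "\<forall>\<^sub>F x in at_bot. u x = u L"
    using eventually_le_at_bot[of L]
  proof eventually_elim
    case (elim x)
    then show ?case using d[of x L] 0 by simp
  qed
  then have "((\<lambda>x::real. u L) \<longlongrightarrow> \<theta>) at_bot" using lim by (simp add: tendsto_cong)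
  then show "u L = \<theta>" by (simp add: tendsto_const_iff)
qed

text \<open>The function \<open>f1 R + k f R\<close> of \<open>k\<close> vanishes exactly at the eigenvalues \<open>- k\<^sup>2\<close>; it is
  expanded by means of the Wronskian of \<open>f\<close> and \<open>u\<close>, which avoids a second solution at zero energy.\<close>
lemma characteristic_function_estimate:
  assumes u: "sl_solution U u u1" and R: "R \<ge> 0" and U: "\<And>x. \<bar>U x\<bar> \<le> B"
    and bc: "u (-R) = 1" "u1 (-R) = 0" "u R = \<theta>" "u1 R = 0"
  shows "\<exists>C\<ge>0. \<forall>w \<eta> k f f1. continuous_on UNIV w \<longrightarrow> (\<forall>x. \<bar>w x\<bar> \<le> \<eta>) \<longrightarrow> \<eta> \<le> 1 \<longrightarrow> 0 \<le> k \<longrightarrow> k \<le> 1 \<longrightarrow>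
     sl_solution (\<lambda>x. U x + w x + k\<^sup>2) f f1 \<longrightarrow> f (-R) = 1 \<longrightarrow> f1 (-R) = k \<longrightarrow>
     \<bar>\<theta> * (f1 R + k * f R) - k * (1 + \<theta>\<^sup>2) - (LINT x:{-R..R}|lborel. w x * (u x)\<^sup>2)\<bar> \<le> C * (k + \<eta>)\<^sup>2"
proof -
  obtain G where G: "\<And>x. x \<in> {-R..R} \<Longrightarrow> \<bar>u x\<bar> \<le> G"
    using continuous_bounded_Icc[OF sl_solution_continuous(1)[OF u]] by blast
  have G0: "G \<ge> 0" using G[of R] R by auto
  have B0: "B \<ge> 0" using U[of 0] by linarith
  \<comment> \<open>The perturbation bound on an interval of length 2 R: \<eta> <= 1 and k^2 <= 1
    bound the potential by B + 2, and k^2 <= k lets k + \<eta> be factored out of the initial and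
    the forcing term.\<close>
  define K where "K = (1 + 2 * R * G) * exp ((1 + (B + 2)) * (R - -R))"
  have K0: "K \<ge> 0" using R G0 by (simp add: K_def)
  define C where "C = \<bar>\<theta>\<bar> * K + 2 * R * (K * G + (G + 2 * K) * G)"
  show ?thesis
  proof (intro exI[of _ C] conjI allI impI)
    show "C \<ge> 0" using R G0 K0 by (simp add: C_def)
    fix w f f1 :: "real \<Rightarrow> real" and \<eta> k :: real
    assume w: "continuous_on UNIV w" "\<forall>x. \<bar>w x\<bar> \<le> \<eta>" "\<eta> \<le> 1" and k: "0 \<le> k" "k \<le> 1"
      and f: "sl_solution (\<lambda>x. U x + w x + k\<^sup>2) f f1" "f (-R) = 1" "f1 (-R) = k"
    have \<eta>0: "\<eta> \<ge> 0" using w(2) by (meson abs_ge_zero order_trans)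
    have kk: "k\<^sup>2 \<le> k" "k\<^sup>2 \<le> 1" using k by (auto simp: power2_eq_square mult_left_le mult_le_one)
    have diff: "\<bar>f x - u x\<bar> \<le> K * (k + \<eta>)" if x: "x \<in> {-R..R}" for x
    proof -
      have "\<bar>f x - u x\<bar> + \<bar>f1 x - u1 x\<bar> \<le> (\<bar>f1 (-R) - u1 (-R)\<bar> + (R - -R) * ((\<eta> + k\<^sup>2) * G)) * exp ((1 + (B + 2)) * (R - -R))"
      proof (rule sl_solution_perturb[OF f(1) u])
        fix t assume t: "-R \<le> t" "t \<le> R"
        have "\<bar>U t + w t + k\<^sup>2\<bar> \<le> \<bar>U t\<bar> + \<bar>w t\<bar> + k\<^sup>2"
          using zero_le_power2[of k] by linarith
        then show "\<bar>U t + w t + k\<^sup>2\<bar> \<le> B + 2"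
          using U[of t] w(2)[rule_format, of t] w(3) kk by linarith
        have "\<bar>w t + k\<^sup>2\<bar> \<le> \<bar>w t\<bar> + k\<^sup>2" using zero_le_power2[of k] by linarith
        then show "\<bar>U t + w t + k\<^sup>2 - U t\<bar> \<le> \<eta> + k\<^sup>2" using w(2)[rule_format, of t] by simp
      qed (use x B0 f bc G in auto)
      also have "\<bar>f1 (-R) - u1 (-R)\<bar> + (R - -R) * ((\<eta> + k\<^sup>2) * G) \<le> (1 + 2 * R * G) * (k + \<eta>)"
      proof -
        have "2 * R * G * (\<eta> + k\<^sup>2) \<le> 2 * R * G * (k + \<eta>)"
          using R G0 kk by (intro mult_left_mono) auto
        then show ?thesis using f bc k \<eta>0 by (simp add: algebra_simps)
      qed
      finally show ?thesis by (simp add: K_def mult_ac)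
    qed
    note cont = sl_solution_continuous[OF f(1)] sl_solution_continuous[OF u]
    have l1: "loc_integrable (\<lambda>x. (U x + w x + k\<^sup>2 - U x) * f x * u x)"
      and l2: "loc_integrable (\<lambda>x. w x * (u x)\<^sup>2)"
      using w(1) cont by (auto intro!: loc_integrable_continuous continuous_intros)
    \<comment> \<open>Because u' vanishes at both ends, the Wronskian equals \<theta> f' R at R and
      k at -R.\<close>
    have "\<theta> * f1 R - k = (LINT x:{-R..R}|lborel. (U x + w x + k\<^sup>2 - U x) * f x * u x)"
      using has_ac_derivD[OF wronskian_has_ac_deriv[OF f(1) u], of "-R" R] R f bc by (simp add: mult.commute)
    then have "\<theta> * (f1 R + k * f R) - k * (1 + \<theta>\<^sup>2) - (LINT x:{-R..R}|lborel. w x * (u x)\<^sup>2)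
      = k * \<theta> * (f R - u R) + ((LINT x:{-R..R}|lborel. (U x + w x + k\<^sup>2 - U x) * f x * u x) - (LINT x:{-R..R}|lborel. w x * (u x)\<^sup>2))"
      by (simp only: bc) (simp add: algebra_simps power2_eq_square)
    also have "(LINT x:{-R..R}|lborel. (U x + w x + k\<^sup>2 - U x) * f x * u x) - (LINT x:{-R..R}|lborel. w x * (u x)\<^sup>2)
      = (LINT x:{-R..R}|lborel. (U x + w x + k\<^sup>2 - U x) * f x * u x - w x * (u x)\<^sup>2)"
      by (intro set_integral_diff(2)[symmetric] loc_integrableD l1 l2)
    finally have eq: "\<theta> * (f1 R + k * f R) - k * (1 + \<theta>\<^sup>2) - (LINT x:{-R..R}|lborel. w x * (u x)\<^sup>2)
      = k * \<theta> * (f R - u R) + (LINT x:{-R..R}|lborel. (U x + w x + k\<^sup>2 - U x) * f x * u x - w x * (u x)\<^sup>2)" .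
    have s: "k * (k + \<eta>) \<le> (k + \<eta>)\<^sup>2" "\<eta> * (k + \<eta>) \<le> (k + \<eta>)\<^sup>2" "k\<^sup>2 \<le> (k + \<eta>)\<^sup>2"
      using k \<eta>0 by (auto simp: power2_eq_square algebra_simps)
    have b1: "\<bar>k * \<theta> * (f R - u R)\<bar> \<le> \<bar>\<theta>\<bar> * K * (k + \<eta>)\<^sup>2"
    proof -
      have "\<bar>k * \<theta> * (f R - u R)\<bar> = k * \<bar>\<theta>\<bar> * \<bar>f R - u R\<bar>" using k by (simp add: abs_mult)
      also have "\<dots> \<le> k * \<bar>\<theta>\<bar> * (K * (k + \<eta>))" using k R diff[of R] by (intro mult_left_mono) auto
      also have "\<dots> = \<bar>\<theta>\<bar> * K * (k * (k + \<eta>))" by simp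
      also have "\<dots> \<le> \<bar>\<theta>\<bar> * K * (k + \<eta>)\<^sup>2" using s K0 by (intro mult_left_mono) auto
      finally show ?thesis .
    qed
    have "\<bar>LINT x:{-R..R}|lborel. (U x + w x + k\<^sup>2 - U x) * f x * u x - w x * (u x)\<^sup>2\<bar>
        \<le> (LINT x:{-R..R}|lborel. (K * G + (G + 2 * K) * G) * (k + \<eta>)\<^sup>2)"
    proof (intro abs_set_integral_le loc_integrable_diff[OF l1 l2])
      fix x assume x: "x \<in> {-R..R}"
      have fb: "\<bar>f x\<bar> \<le> G + 2 * K"
      proof -
        have "K * (k + \<eta>) \<le> K * 2" using K0 k w(3) by (intro mult_left_mono) auto
        then show ?thesis using diff[OF x] G[OF x] by linarith
      qed
      \<comment> \<open>The first summand is second order since w = O(\<eta>) and f - u = O(k +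
        \<eta>); the second carries k^2 and needs only that f and u are bounded.\<close>
      have "(U x + w x + k\<^sup>2 - U x) * f x * u x - w x * (u x)\<^sup>2 = w x * (f x - u x) * u x + k\<^sup>2 * f x * u x"
        by (simp add: algebra_simps power2_eq_square)
      also have "\<bar>\<dots>\<bar> \<le> \<bar>w x\<bar> * \<bar>f x - u x\<bar> * \<bar>u x\<bar> + k\<^sup>2 * \<bar>f x\<bar> * \<bar>u x\<bar>"
        using abs_triangle_ineq[of "w x * (f x - u x) * u x" "k\<^sup>2 * f x * u x"] by (simp add: abs_mult)
      also have "\<dots> \<le> \<eta> * (K * (k + \<eta>)) * G + k\<^sup>2 * (G + 2 * K) * G"
        using w(2) diff[OF x] G[OF x] fb \<eta>0 K0 G0 k by (intro add_mono mult_mono) auto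
      also have "\<dots> = K * G * (\<eta> * (k + \<eta>)) + (G + 2 * K) * G * k\<^sup>2" by (simp add: mult_ac)
      also have "\<dots> \<le> K * G * (k + \<eta>)\<^sup>2 + (G + 2 * K) * G * (k + \<eta>)\<^sup>2"
        using s K0 G0 by (intro add_mono mult_left_mono) auto
      finally show "\<bar>(U x + w x + k\<^sup>2 - U x) * f x * u x - w x * (u x)\<^sup>2\<bar> \<le> (K * G + (G + 2 * K) * G) * (k + \<eta>)\<^sup>2"
        by (simp add: distrib_right)
    qed (auto intro!: loc_integrable_continuous)
    also have "\<dots> = 2 * R * (K * G + (G + 2 * K) * G) * (k + \<eta>)\<^sup>2"
      using R by (simp add: set_integral_Icc_const)
    finally show "\<bar>\<theta> * (f1 R + k * f R) - k * (1 + \<theta>\<^sup>2) - (LINT x:{-R..R}|lborel. w x * (u x)\<^sup>2)\<bar> \<le> C * (k + \<eta>)\<^sup>2"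
      unfolding eq using b1 by (simp add: C_def distrib_right)
  qed
qed

text \<open>Supplies the continuity for the intermediate value theorem. The solution for k is
  compared with the one for a fixed l: the potentials differ by k^2 - l^2 and the initial slopes by
  k - l, and restricting to |k - l| < 1 keeps the Gronwall exponent bounded.\<close>

lemma characteristic_function_continuous:
  assumes W: "\<And>x. \<bar>W x\<bar> \<le> B" and "c \<le> d"
    and sol: "\<And>k. sl_solution (\<lambda>x. W x + k\<^sup>2) (f k) (f1 k)" "\<And>k. f k c = 1" "\<And>k. f1 k c = k"
  shows "continuous_on UNIV (\<lambda>k. f1 k d + k * f k d)"
proof -
  have "isCont (\<lambda>k. f1 k d + k * f k d) l" for l
  proof -
    obtain G where G: "\<And>x. x \<in> {c..d} \<Longrightarrow> \<bar>f l x\<bar> \<le> G"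
      using continuous_bounded_Icc[OF sl_solution_continuous(1)[OF sol(1)]] by blast
    define E where "E = exp ((1 + (B + (\<bar>l\<bar> + 1)\<^sup>2)) * (d - c))"
    define b where "b k = (\<bar>k - l\<bar> + (d - c) * (\<bar>k\<^sup>2 - l\<^sup>2\<bar> * G)) * E" for k
    have B0: "B \<ge> 0" using W[of 0] by linarith
    have bound: "\<bar>f k d - f l d\<bar> + \<bar>f1 k d - f1 l d\<bar> \<le> b k" if k: "\<bar>k - l\<bar> < 1" for k
    proof -
      have "\<bar>f k d - f l d\<bar> + \<bar>f1 k d - f1 l d\<bar> \<le> (\<bar>f1 k c - f1 l c\<bar> + (d - c) * (\<bar>k\<^sup>2 - l\<^sup>2\<bar> * G)) * exp ((1 + (B + (\<bar>l\<bar> + 1)\<^sup>2)) * (d - c))"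
      proof (rule sl_solution_perturb[OF sol(1) sol(1)])
        fix t
        have "\<bar>k\<bar> \<le> \<bar>l\<bar> + 1" using k by linarith
        then have "\<bar>k\<bar>\<^sup>2 \<le> (\<bar>l\<bar> + 1)\<^sup>2" by (intro power_mono) auto
        then show "\<bar>W t + k\<^sup>2\<bar> \<le> B + (\<bar>l\<bar> + 1)\<^sup>2"
          using W[of t] abs_triangle_ineq[of "W t" "k\<^sup>2"] by simp
      qed (use \<open>c \<le> d\<close> sol G B0 in auto)
      then show ?thesis by (simp add: b_def E_def sol)
    qed
    have ev: "\<forall>\<^sub>F k in at l. \<bar>k - l\<bar> < 1"
      using eventually_at[of "\<lambda>k. \<bar>k - l\<bar> < 1" l UNIV] by (auto simp: dist_real_def intro: exI[of _ 1])
    have b0: "(b \<longlongrightarrow> 0) (at l)"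
    proof -
      have "isCont b l" unfolding b_def by (intro continuous_intros)
      then show ?thesis by (simp add: isCont_def b_def)
    qed
    have "((\<lambda>k. f k d - f l d) \<longlongrightarrow> 0) (at l)"
      by (rule Lim_null_comparison[OF _ b0]) (use ev in eventually_elim, use bound in force)
    moreover have "((\<lambda>k. f1 k d - f1 l d) \<longlongrightarrow> 0) (at l)"
      by (rule Lim_null_comparison[OF _ b0]) (use ev in eventually_elim, use bound in force)
    ultimately have "isCont (\<lambda>k. f k d) l" "isCont (\<lambda>k. f1 k d) l"
      by (simp_all add: isCont_def LIM_zero_iff)
    then show ?thesis by (intro continuous_intros)
  qed
  then show ?thesis by (simp add: continuous_at_imp_continuous_on)
qed

section \<open>The first-order term\<close>

lemma has_ac_deriv_scale:
  fixes V :: "real \<Rightarrow> real"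
  assumes V: "has_ac_deriv V V'" and c: "c > 0"
  shows "has_ac_deriv (\<lambda>x. V (c * x)) (\<lambda>x. c * V' (c * x))"
  unfolding has_ac_deriv_def
proof (intro allI impI)
  fix a b :: real assume "a \<le> b"
  then have ab: "c * a \<le> c * b" using c by simp
  have ind: "indicator {c * a..c * b} (0 + c * x) = (indicator {a..b} x :: real)" for x
    using c by (auto simp: indicator_def)
  have "integrable lborel (\<lambda>x. indicator {c * a..c * b} (0 + c * x) *\<^sub>R V' (0 + c * x))"
    using loc_integrableD[OF has_ac_deriv_loc_integrable[OF V], of "c * a" "c * b"] c
    unfolding set_integrable_def by (intro lborel_integrable_real_affine[where f="\<lambda>x. indicator {c * a..c * b} x *\<^sub>R V' x"]) auto
  then have i: "set_integrable lborel {a..b} (\<lambda>x. V' (c * x))"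
    unfolding set_integrable_def ind by simp
  have "(LINT t:{c * a..c * b}|lborel. V' t) = \<bar>c\<bar> *\<^sub>R (\<integral>x. indicator {c * a..c * b} (0 + c * x) *\<^sub>R V' (0 + c * x) \<partial>lborel)"
    unfolding set_lebesgue_integral_def by (rule lborel_integral_real_affine) (use c in simp)
  also have "\<dots> = (LINT t:{a..b}|lborel. c * V' (c * t))"
    unfolding ind using c by (simp add: set_lebesgue_integral_def mult.left_commute)
  finally show "set_integrable lborel {a..b} (\<lambda>x. c * V' (c * x)) \<and>
     V (c * b) - V (c * a) = (LINT t:{a..b}|lborel. c * V' (c * t))"
    using i has_ac_derivD[OF V ab] by simp
qed

lemma integral_eq_set_integral_support:
  fixes f :: "real \<Rightarrow> real"
  assumes "\<And>x. x \<notin> S \<Longrightarrow> f x = 0"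
  shows "(\<integral>x. f x \<partial>lborel) = (LINT x:S|lborel. f x)"
  unfolding set_lebesgue_integral_def
  by (intro Bochner_Integration.integral_cong) (use assms in \<open>auto simp: indicator_def\<close>)

lemma set_integral_symmetric_tendsto:
  fixes f :: "real \<Rightarrow> real"
  assumes f: "integrable lborel f"
  shows "(\<lambda>n. LINT x:{- real n..real n}|lborel. f x) \<longlonglongrightarrow> (\<integral>x. f x \<partial>lborel)"
  unfolding set_lebesgue_integral_def
proof (rule integral_dominated_convergence)
  show "integrable lborel (\<lambda>x. \<bar>f x\<bar>)" using f by simp
  show "AE x in lborel. (\<lambda>n. indicator {- real n..real n} x *\<^sub>R f x) \<longlonglongrightarrow> f x"
  proof (intro AE_I2 tendsto_eventually)
    fix x
    obtain N :: nat where "\<bar>x\<bar> \<le> real N" using real_arch_simple by blast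
    then have "indicator {- real n..real n} x *\<^sub>R f x = f x" if "n \<ge> N" for n
      using that by (auto simp: indicator_def)
    then show "\<forall>\<^sub>F n in sequentially. indicator {- real n..real n} x *\<^sub>R f x = f x"
      using eventually_ge_at_top[of N] by (rule eventually_mono[rotated])
  qed
  show "AE x in lborel. norm (indicator {- real n..real n} x *\<^sub>R f x) \<le> \<bar>f x\<bar>" for n
    by (auto simp: indicator_def)
qed (use f in auto)

text \<open>After the substitution \<open>t = b x\<close> the parameter \<open>b\<close> occurs only in the continuously
  differentiable function \<open>u\<close>, so that differentiating under the integral sign needs nothing about \<open>V'\<close>.\<close>
lemma first_order_term_deriv:
  assumes V: "continuous_on UNIV V" "\<And>x. \<bar>x\<bar> > \<rho> \<Longrightarrow> V x = 0"
    and u: "has_ac_deriv u u1" "continuous_on UNIV u1" and \<alpha>: "\<alpha> > 0"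
  shows "((\<lambda>b. \<integral>x. b * V (b * x) * (u x)\<^sup>2 \<partial>lborel) has_real_derivative
          - (\<integral>x. V (\<alpha> * x) * (2 * x * u x * u1 x) \<partial>lborel)) (at \<alpha>)"
proof -
  have du: "DERIV u x :> u1 x" for x by (rule has_ac_deriv_DERIV[OF u])
  have cu: "continuous_on UNIV u" by (rule has_ac_deriv_continuous[OF u(1)])
  have c1: "continuous_on UNIV (\<lambda>t. V t * (u (t / b))\<^sup>2)" if "b \<noteq> 0" for b
    by (intro continuous_intros V continuous_on_compose2[OF cu]) (use that in auto)
  have eq: "(\<integral>x. b * V (b * x) * (u x)\<^sup>2 \<partial>lborel) = integral {-\<rho>..\<rho>} (\<lambda>t. V t * (u (t / b))\<^sup>2)" if "b > 0" for b
  proof -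
    have "(\<integral>t. V t * (u (t / b))\<^sup>2 \<partial>lborel) = \<bar>b\<bar> *\<^sub>R (\<integral>x. V (0 + b * x) * (u ((0 + b * x) / b))\<^sup>2 \<partial>lborel)"
      by (rule lborel_integral_real_affine) (use that in simp)
    also have "\<dots> = (\<integral>x. b * V (b * x) * (u x)\<^sup>2 \<partial>lborel)"
      using that by (simp add: mult.assoc)
    also have "(\<integral>t. V t * (u (t / b))\<^sup>2 \<partial>lborel) = (LINT t:{-\<rho>..\<rho>}|lborel. V t * (u (t / b))\<^sup>2)"
      by (intro integral_eq_set_integral_support) (use V(2) in force)
    also have "\<dots> = integral {-\<rho>..\<rho>} (\<lambda>t. V t * (u (t / b))\<^sup>2)"
      by (intro set_borel_integral_eq_integral(2) loc_integrableD loc_integrable_continuous c1) (use that in simp)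
    finally show ?thesis by simp
  qed
  define f' where "f' b t = V t * (2 * u (t / b) * (u1 (t / b) * (- t / b\<^sup>2)))" for b t
  have cf': "continuous_on ({\<alpha>/2<..} \<times> UNIV) (\<lambda>(b, t). f' b t)"
    unfolding f'_def case_prod_beta
    by (intro continuous_intros continuous_on_compose2[OF V(1)] continuous_on_compose2[OF cu] continuous_on_compose2[OF u(2)])
       (use \<alpha> in auto)
  \<comment> \<open>The half-line beyond \<alpha> / 2 is an open convex neighbourhood of \<alpha>
    that stays away from 0, so t / b is jointly continuous there.\<close>
  have "((\<lambda>b. integral (cbox (-\<rho>) \<rho>) (\<lambda>t. V t * (u (t / b))\<^sup>2)) has_field_derivative integral (cbox (-\<rho>) \<rho>) (f' \<alpha>)) (at \<alpha> within {\<alpha>/2<..})"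
  proof (rule leibniz_rule_field_derivative)
    fix b t assume "b \<in> {\<alpha>/2<..}" and "t \<in> cbox (-\<rho>) \<rho>"
    then have b: "b > 0" using \<alpha> by simp
    have "((\<lambda>b. u (t / b)) has_real_derivative u1 (t / b) * (- t / b\<^sup>2)) (at b within {\<alpha>/2<..})"
      by (rule DERIV_chain2[OF du]) (use b in \<open>auto intro!: derivative_eq_intros simp: power2_eq_square\<close>)
    then show "((\<lambda>b. V t * (u (t / b))\<^sup>2) has_field_derivative f' b t) (at b within {\<alpha>/2<..})"
      unfolding f'_def by (auto intro!: derivative_eq_intros)
  next
    show "(\<lambda>t. V t * (u (t / b))\<^sup>2) integrable_on cbox (-\<rho>) \<rho>" if "b \<in> {\<alpha>/2<..}" for b
      by (intro integrable_continuous continuous_on_subset[OF c1]) (use \<alpha> that in auto)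
    show "continuous_on ({\<alpha>/2<..} \<times> cbox (-\<rho>) \<rho>) (\<lambda>(b, t). f' b t)"
      by (rule continuous_on_subset[OF cf']) auto
  qed (use \<alpha> in auto)
  moreover have "at \<alpha> within {\<alpha>/2<..} = at \<alpha>"
    using \<alpha> by (intro at_within_open) auto
  ultimately have "((\<lambda>b. integral {-\<rho>..\<rho>} (\<lambda>t. V t * (u (t / b))\<^sup>2)) has_real_derivative integral {-\<rho>..\<rho>} (f' \<alpha>)) (at \<alpha>)"
    by simp
  then have "((\<lambda>b. \<integral>x. b * V (b * x) * (u x)\<^sup>2 \<partial>lborel) has_real_derivative integral {-\<rho>..\<rho>} (f' \<alpha>)) (at \<alpha>)"
    by (rule has_field_derivative_transform_within_open[of _ _ _ "{0<..}"]) (use \<alpha> eq in auto)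
  moreover have "integral {-\<rho>..\<rho>} (f' \<alpha>) = - (\<integral>x. V (\<alpha> * x) * (2 * x * u x * u1 x) \<partial>lborel)"
  proof -
    have "continuous_on UNIV (f' \<alpha>)"
      unfolding f'_def
      by (intro continuous_intros V continuous_on_compose2[OF cu] continuous_on_compose2[OF u(2)]) (use \<alpha> in auto)
    then have "integral {-\<rho>..\<rho>} (f' \<alpha>) = (LINT t:{-\<rho>..\<rho>}|lborel. f' \<alpha> t)"
      by (intro set_borel_integral_eq_integral(2)[symmetric] loc_integrableD loc_integrable_continuous)
    also have "\<dots> = (\<integral>t. f' \<alpha> t \<partial>lborel)"
      by (intro integral_eq_set_integral_support[symmetric]) (use V(2) in \<open>force simp: f'_def\<close>)
    also have "\<dots> = \<bar>\<alpha>\<bar> *\<^sub>R (\<integral>x. f' \<alpha> (0 + \<alpha> * x) \<partial>lborel)"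
      by (rule lborel_integral_real_affine) (use \<alpha> in simp)
    also have "\<dots> = (\<integral>x. \<alpha> * f' \<alpha> (\<alpha> * x) \<partial>lborel)" using \<alpha> by simp
    also have "\<dots> = (\<integral>x. - (V (\<alpha> * x) * (2 * x * u x * u1 x)) \<partial>lborel)"
      using \<alpha> by (intro Bochner_Integration.integral_cong) (auto simp: f'_def power2_eq_square field_simps)
    finally show ?thesis by simp
  qed
  ultimately show ?thesis by simp
qed

text \<open>The product rule for V (\<alpha> x) times x u^2, integrated past the support of V, where
  the boundary terms vanish. It rewrites the derivative found in
  \<open>first_order_term_deriv\<close> in terms of V'.\<close>

lemma integration_by_parts_scaled:
  assumes V: "has_ac_deriv V V'" "\<And>x. \<bar>x\<bar> > \<rho> \<Longrightarrow> V x = 0"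
    and u: "has_ac_deriv u u1" "continuous_on UNIV u1" and \<alpha>: "\<alpha> > 0"
    and int: "integrable lborel (\<lambda>x. x * V' (\<alpha> * x) * (u x)\<^sup>2)"
  shows "\<alpha> * (\<integral>x. x * V' (\<alpha> * x) * (u x)\<^sup>2 \<partial>lborel) =
    - (\<integral>x. V (\<alpha> * x) * (u x)\<^sup>2 \<partial>lborel) - (\<integral>x. V (\<alpha> * x) * (2 * x * u x * u1 x) \<partial>lborel)"
    (is "\<alpha> * ?I = - ?J0 - ?J1")
proof -
  have cu: "continuous_on UNIV u" by (rule has_ac_deriv_continuous[OF u(1)])
  have cV: "continuous_on UNIV (\<lambda>x. V (\<alpha> * x))"
    by (intro continuous_on_compose2[OF has_ac_deriv_continuous[OF V(1)]] continuous_intros) auto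
  have h: "has_ac_deriv (\<lambda>x. x * (u x)\<^sup>2) (\<lambda>x. (u x)\<^sup>2 + 2 * x * u x * u1 x)"
    by (intro DERIV_has_ac_deriv continuous_intros cu u(2))
       (auto intro!: derivative_eq_intros has_ac_deriv_DERIV[OF u] simp: algebra_simps)
  have p: "has_ac_deriv (\<lambda>x. V (\<alpha> * x) * (x * (u x)\<^sup>2))
     (\<lambda>x. \<alpha> * V' (\<alpha> * x) * (x * (u x)\<^sup>2) + V (\<alpha> * x) * ((u x)\<^sup>2 + 2 * x * u x * u1 x))"
    by (intro has_ac_deriv_mult has_ac_deriv_scale V \<alpha> h continuous_intros cu u(2))
  have l0: "loc_integrable (\<lambda>x. V (\<alpha> * x) * (u x)\<^sup>2)" and l1: "loc_integrable (\<lambda>x. V (\<alpha> * x) * (2 * x * u x * u1 x))"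
    by (intro loc_integrable_continuous continuous_intros cV cu u(2))+
  have l2: "loc_integrable (\<lambda>x. x * V' (\<alpha> * x) * (u x)\<^sup>2)"
    unfolding loc_integrable_def set_integrable_def
    by (intro allI integrable_mult_indicator int) simp
  \<comment> \<open>As a density, V' is determined only up to null sets and need not vanish
    pointwise off the support of V. So the identity is proved on [-n, n] for all large n, and the
    integral with V' is recovered as a limit.\<close>
  obtain N :: nat where N: "\<rho> / \<alpha> < real N" using reals_Archimedean2 by blast
  have "(LINT x:{- real n..real n}|lborel. x * V' (\<alpha> * x) * (u x)\<^sup>2) = (- ?J0 - ?J1) / \<alpha>" if n: "n \<ge> N" for n :: nat
  proof -
    have n': "real n > \<rho> / \<alpha>" using n N by linarith
    then have \<rho>n: "\<alpha> * real n > \<rho>" using \<alpha> by (simp add: divide_less_eq mult.commute)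
    have supp: "V (\<alpha> * x) = 0" if "x \<notin> {- real n..real n}" for x
    proof (rule V(2))
      have "real n \<le> \<bar>x\<bar>" using that by auto
      then have "\<alpha> * real n \<le> \<bar>\<alpha> * x\<bar>" using \<alpha> by (simp add: abs_mult)
      then show "\<bar>\<alpha> * x\<bar> > \<rho>" using \<rho>n by linarith
    qed
    have "V (\<alpha> * real n) = 0" "V (\<alpha> * - real n) = 0"
      using \<rho>n \<alpha> by (auto intro!: V(2) simp: abs_mult)
    then have "0 = (LINT x:{- real n..real n}|lborel. \<alpha> * V' (\<alpha> * x) * (x * (u x)\<^sup>2) + V (\<alpha> * x) * ((u x)\<^sup>2 + 2 * x * u x * u1 x))"
      using has_ac_derivD[OF p, of "- real n" "real n"] by simp
    also have "\<dots> = (LINT x:{- real n..real n}|lborel. \<alpha> * (x * V' (\<alpha> * x) * (u x)\<^sup>2) + (V (\<alpha> * x) * (u x)\<^sup>2 + V (\<alpha> * x) * (2 * x * u x * u1 x)))"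
      by (simp add: algebra_simps)
    also have "\<dots> = \<alpha> * (LINT x:{- real n..real n}|lborel. x * V' (\<alpha> * x) * (u x)\<^sup>2) +
       ((LINT x:{- real n..real n}|lborel. V (\<alpha> * x) * (u x)\<^sup>2) + (LINT x:{- real n..real n}|lborel. V (\<alpha> * x) * (2 * x * u x * u1 x)))"
      using loc_integrableD[OF l0] loc_integrableD[OF l1] loc_integrableD[OF l2]
      by (subst set_integral_add(2), simp, simp add: set_integral_add, subst set_integral_add(2), simp_all)
    also have "(LINT x:{- real n..real n}|lborel. V (\<alpha> * x) * (u x)\<^sup>2) = ?J0"
      by (intro integral_eq_set_integral_support[symmetric]) (simp add: supp)
    also have "(LINT x:{- real n..real n}|lborel. V (\<alpha> * x) * (2 * x * u x * u1 x)) = ?J1"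
      by (intro integral_eq_set_integral_support[symmetric]) (simp add: supp)
    finally show ?thesis using \<alpha> by (simp add: field_simps)
  qed
  then have "\<forall>\<^sub>F n in sequentially. (LINT x:{- real n..real n}|lborel. x * V' (\<alpha> * x) * (u x)\<^sup>2) = (- ?J0 - ?J1) / \<alpha>"
    using eventually_ge_at_top[of N] by (rule eventually_mono[rotated])
  then have "(\<lambda>n::nat. (- ?J0 - ?J1) / \<alpha>) \<longlonglongrightarrow> ?I"
    using set_integral_symmetric_tendsto[OF int] by (simp add: tendsto_cong)
  then have "(- ?J0 - ?J1) / \<alpha> = ?I" by (simp add: LIMSEQ_const_iff)
  then show ?thesis using \<alpha> by (simp add: field_simps)
qed

section \<open>Asymptotics of the root\<close>

text \<open>Separates the limit computations from the differential equation: what remains of the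
  latter is a relation k S + lam F (a lam) = O((k + A lam)^2).\<close>

locale threshold_scaling =
  fixes a F :: "real \<Rightarrow> real" and \<alpha> F' :: real
  assumes a_lim: "(a \<longlongrightarrow> \<alpha>) (at_right 0)"
    and rate: "filterlim (\<lambda>lam. (a lam - \<alpha>) / lam powr (1/3)) at_top (at_right 0)"
    and F: "DERIV F \<alpha> :> F'" "F \<alpha> = 0"
begin

lemma a_gt: "\<forall>\<^sub>F lam in at_right 0. a lam > \<alpha>"
proof -
  have "\<forall>\<^sub>F lam in at_right 0. 1 \<le> (a lam - \<alpha>) / lam powr (1/3)"
    using rate by (simp add: filterlim_at_top)
  then show ?thesis using eventually_at_right_less[of "0::real"]
  proof eventually_elim
    case (elim lam)
    then have "0 < (a lam - \<alpha>) / lam powr (1/3)" by linarith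
    then show ?case using elim by (simp add: zero_less_divide_iff)
  qed
qed

text \<open>The quotient is lam^(2/3) times the reciprocal of the expression in \<open>rate\<close>,
  and both factors tend to 0. This makes remainders of order lam^2 negligible against lam (a lam -
  \<alpha>).\<close>

lemma lam_over_diff: "((\<lambda>lam. lam / (a lam - \<alpha>)) \<longlongrightarrow> 0) (at_right 0)"
proof -
  have "((\<lambda>lam::real. lam powr (2/3)) \<longlongrightarrow> 0 powr (2/3)) (at_right 0)"
    by (rule tendsto_powr2)
       (auto intro: tendsto_ident_at eventually_mono[OF eventually_at_right_less[of "0::real"]])
  moreover have "((\<lambda>lam. inverse ((a lam - \<alpha>) / lam powr (1/3))) \<longlongrightarrow> 0) (at_right 0)"
    by (rule tendsto_inverse_0_at_top[OF rate])
  ultimately have "((\<lambda>lam. lam powr (2/3) * inverse ((a lam - \<alpha>) / lam powr (1/3))) \<longlongrightarrow> 0) (at_right 0)"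
    using tendsto_mult by fastforce
  moreover have "\<forall>\<^sub>F lam in at_right 0. lam powr (2/3) * inverse ((a lam - \<alpha>) / lam powr (1/3)) = lam / (a lam - \<alpha>)"
    using eventually_at_right_less[of "0::real"]
  proof eventually_elim
    case (elim lam)
    have e: "lam powr (2/3) * lam powr (1/3) = lam" using elim by (simp add: powr_add[symmetric])
    have "lam powr (2/3) * inverse (x / lam powr (1/3)) = (lam powr (2/3) * lam powr (1/3)) / x" for x
      by simp
    then show ?case by (simp only: e)
  qed
  ultimately show ?thesis by (rule Lim_transform_eventually)
qed

lemma F_over_diff: "((\<lambda>lam. F (a lam) / (a lam - \<alpha>)) \<longlongrightarrow> F') (at_right 0)"
proof -
  have "((\<lambda>b. (F b - F \<alpha>) / (b - \<alpha>)) \<longlongrightarrow> F') (at \<alpha>)"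
    using F(1) by (simp add: has_field_derivative_iff)
  \<comment> \<open>The punctured filter at \<alpha> requires a lam to differ from \<alpha>
    eventually, which \<open>a_gt\<close> provides.\<close>
  moreover have "filterlim a (at \<alpha>) (at_right 0)"
    using a_lim a_gt by (simp add: filterlim_at eventually_mono)
  ultimately have "((\<lambda>lam. (F (a lam) - F \<alpha>) / (a lam - \<alpha>)) \<longlongrightarrow> F') (at_right 0)"
    by (rule filterlim_compose)
  then show ?thesis by (simp add: F(2))
qed

lemma diff_tendsto_0: "((\<lambda>lam. a lam - \<alpha>) \<longlongrightarrow> 0) (at_right 0)"
  using a_lim by (simp add: LIM_zero)

lemma lam_tendsto_0: "((\<lambda>lam::real. lam) \<longlongrightarrow> 0) (at_right 0)"
  by (rule tendsto_ident_at)

text \<open>Division by lam (a lam - \<alpha>) gives r S + q = O(k r) + o(1) for the rescaled root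
  r. Since k -> 0, the term k r is first absorbed to bound r; then it tends to 0, and r S + q -> 0
  determines the limit.\<close>

lemma root_asymptotics:
  assumes S: "S \<ge> 1" and C: "C \<ge> 0" and k0: "(k \<longlongrightarrow> 0) (at_right 0)"
    and k: "\<forall>\<^sub>F lam in at_right 0. k lam > 0 \<and> \<bar>k lam * S + lam * F (a lam)\<bar> \<le> C * (k lam + A * lam)\<^sup>2"
  shows "((\<lambda>lam. k lam / (lam * (a lam - \<alpha>))) \<longlongrightarrow> - F' / S) (at_right 0)"
proof -
  define r where "r lam = k lam / (lam * (a lam - \<alpha>))" for lam
  define q where "q lam = F (a lam) / (a lam - \<alpha>)" for lam
  define t where "t lam = 2 * C * A\<^sup>2 * (lam / (a lam - \<alpha>))" for lam
  have q: "(q \<longlongrightarrow> F') (at_right 0)" unfolding q_def by (rule F_over_diff)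
  have t: "(t \<longlongrightarrow> 0) (at_right 0)"
    unfolding t_def using tendsto_mult_right_zero[OF lam_over_diff] by blast
  have main: "\<forall>\<^sub>F lam in at_right 0. r lam > 0 \<and> \<bar>r lam * S + q lam\<bar> \<le> 2 * C * (k lam * r lam) + t lam"
    using k a_gt eventually_at_right_less[of "0::real"]
  proof eventually_elim
    case (elim lam)
    define d where "d = lam * (a lam - \<alpha>)"
    have d: "d > 0" using elim by (simp add: d_def)
    have "(k lam + A * lam)\<^sup>2 \<le> 2 * (k lam)\<^sup>2 + 2 * (A * lam)\<^sup>2"
      using zero_le_power2[of "k lam - A * lam"] by (simp add: power2_eq_square algebra_simps)
    then have "C * (k lam + A * lam)\<^sup>2 \<le> C * (2 * (k lam)\<^sup>2 + 2 * (A * lam)\<^sup>2)"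
      using C by (rule mult_left_mono)
    then have "\<bar>k lam * S + lam * F (a lam)\<bar> / d \<le> C * (2 * (k lam)\<^sup>2 + 2 * (A * lam)\<^sup>2) / d"
      using elim d by (intro divide_right_mono) auto
    also have "C * (2 * (k lam)\<^sup>2 + 2 * (A * lam)\<^sup>2) / d = 2 * C * (k lam * r lam) + t lam"
    proof -
      have "C * (2 * x\<^sup>2 + 2 * (A * l)\<^sup>2) / (l * z) = 2 * C * (x * (x / (l * z))) + 2 * C * A\<^sup>2 * (l / z)"
        if "l > 0" "z > 0" for x l z
        using that by (simp add: power2_eq_square field_simps)
      from this[of lam "a lam - \<alpha>" "k lam"] show ?thesis using elim by (simp add: r_def t_def d_def)
    qed
    also have "\<bar>k lam * S + lam * F (a lam)\<bar> / d = \<bar>(k lam * S + lam * F (a lam)) / d\<bar>"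
      using d by simp
    also have "(k lam * S + lam * F (a lam)) / d = r lam * S + q lam"
      using elim by (simp add: r_def q_def d_def add_divide_distrib)
    finally show ?case using elim by (simp add: r_def)
  qed
  \<comment> \<open>Together with S >= 1 this bounds the error term by r / 2, leaving r / 2 <= |q| +
    t on the way to boundedness of r.\<close>
  have small: "\<forall>\<^sub>F lam in at_right 0. 2 * C * k lam < 1/2"
    using order_tendstoD(2)[OF tendsto_mult_right_zero[OF k0, of "2 * C"], of "1/2"] by simp
  have qb: "\<forall>\<^sub>F lam in at_right 0. \<bar>q lam\<bar> < \<bar>F'\<bar> + 1"
    using order_tendstoD(2)[OF tendsto_rabs[OF q], of "\<bar>F'\<bar> + 1"] by simp
  have tb: "\<forall>\<^sub>F lam in at_right 0. t lam < 1"
    using order_tendstoD(2)[OF t, of 1] by simp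
  have rb: "\<forall>\<^sub>F lam in at_right 0. \<bar>r lam\<bar> \<le> 2 * (\<bar>F'\<bar> + 2)"
    using main small qb tb
  proof eventually_elim
    case (elim lam)
    have 1: "r lam * 1 \<le> r lam * S" using elim S by (intro mult_left_mono) auto
    have "2 * C * k lam * r lam \<le> 1/2 * r lam" using elim by (intro mult_right_mono) auto
    then have "2 * C * (k lam * r lam) \<le> 1/2 * r lam" by (simp only: mult.assoc)
    moreover have "r lam * S + q lam \<le> 2 * C * (k lam * r lam) + t lam"
      using elim(1) abs_le_D1 by blast
    moreover have "- q lam < \<bar>F'\<bar> + 1" using elim(3) by linarith
    ultimately have "r lam \<le> 2 * (\<bar>F'\<bar> + 2)" using 1 elim(4) by argo
    then show ?case using elim(1) by simp
  qed
  have "((\<lambda>lam. 2 * C * (k lam * r lam) + t lam) \<longlongrightarrow> 2 * C * 0 + 0) (at_right 0)"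
  proof (intro tendsto_add tendsto_mult_left t)
    have "((\<lambda>lam. \<bar>k lam\<bar> * (2 * (\<bar>F'\<bar> + 2))) \<longlongrightarrow> 0) (at_right 0)"
      using tendsto_mult_left_zero[OF tendsto_rabs_zero[OF k0]] .
    then show "((\<lambda>lam. k lam * r lam) \<longlongrightarrow> 0) (at_right 0)"
    proof (rule Lim_null_comparison[rotated])
      show "\<forall>\<^sub>F lam in at_right 0. norm (k lam * r lam) \<le> \<bar>k lam\<bar> * (2 * (\<bar>F'\<bar> + 2))"
        using rb by eventually_elim (auto simp: abs_mult intro!: mult_left_mono)
    qed
  qed
  then have "((\<lambda>lam. r lam * S + q lam) \<longlongrightarrow> 0) (at_right 0)"
    by (intro Lim_null_comparison[of "\<lambda>lam. r lam * S + q lam" "\<lambda>lam. 2 * C * (k lam * r lam) + t lam"])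
       (use main in \<open>auto elim: eventually_mono\<close>)
  then have "((\<lambda>lam. (r lam * S + q lam - q lam) / S) \<longlongrightarrow> (0 - F') / S) (at_right 0)"
    using S by (intro tendsto_intros q) auto
  then show ?thesis using S by (simp add: r_def)
qed

text \<open>Evaluates the characteristic function at the trial exponent c lam (a lam - \<alpha>).
  The limit changes sign at c = -F' / S, so trial values on either side of it bracket a
  root.\<close>

lemma sign_asymptotics:
  assumes G: "\<forall>\<^sub>F lam in at_right 0. \<bar>G lam - c * (lam * (a lam - \<alpha>)) * S - lam * F (a lam)\<bar> \<le> C * (c * (lam * (a lam - \<alpha>)) + A * lam)\<^sup>2"
  shows "((\<lambda>lam. G lam / (lam * (a lam - \<alpha>))) \<longlongrightarrow> c * S + F') (at_right 0)"
proof -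
  define b where "b lam = C * (c * (a lam - \<alpha>) + A)\<^sup>2 * (lam / (a lam - \<alpha>))" for lam
  have "(b \<longlongrightarrow> C * (c * 0 + A)\<^sup>2 * 0) (at_right 0)"
    unfolding b_def by (intro tendsto_intros lam_over_diff diff_tendsto_0)
  then have b: "(b \<longlongrightarrow> 0) (at_right 0)" by simp
  have "((\<lambda>lam. G lam / (lam * (a lam - \<alpha>)) - c * S - F (a lam) / (a lam - \<alpha>)) \<longlongrightarrow> 0) (at_right 0)"
  proof (rule Lim_null_comparison[OF _ b])
    show "\<forall>\<^sub>F lam in at_right 0. norm (G lam / (lam * (a lam - \<alpha>)) - c * S - F (a lam) / (a lam - \<alpha>)) \<le> b lam"
      using G a_gt eventually_at_right_less[of "0::real"]
    proof eventually_elim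
      case (elim lam)
      define d where "d = lam * (a lam - \<alpha>)"
      have d: "d > 0" using elim by (simp add: d_def)
      have "G lam / d - c * S - F (a lam) / (a lam - \<alpha>) = (G lam - c * d * S - lam * F (a lam)) / d"
        using elim by (simp add: d_def diff_divide_distrib)
      moreover have "\<bar>G lam - c * d * S - lam * F (a lam)\<bar> / d \<le> C * (c * d + A * lam)\<^sup>2 / d"
        using elim d by (intro divide_right_mono) (auto simp: d_def)
      moreover have "C * (c * d + A * lam)\<^sup>2 / d = b lam"
      proof -
        have "c * d + A * lam = lam * (c * (a lam - \<alpha>) + A)" by (simp add: d_def algebra_simps)
        then show ?thesis using elim by (simp add: b_def d_def power_mult_distrib power2_eq_square)
      qed
      ultimately show ?case using d by (simp add: d_def)
    qed
  qed
  then have "((\<lambda>lam. (G lam / (lam * (a lam - \<alpha>)) - c * S - F (a lam) / (a lam - \<alpha>)) + c * S + F (a lam) / (a lam - \<alpha>)) \<longlongrightarrow> 0 + c * S + F') (at_right 0)"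
    by (intro tendsto_intros F_over_diff)
  then show ?thesis by simp
qed

end

text \<open>The o(1) formula is expressed as convergence of the quotient, whose denominator is
  eventually positive, and it is claimed for every eigenvalue family e that tends to 0.\<close>

theorem theorem2:
  fixes U V V' u :: "real \<Rightarrow> real" and a :: "real \<Rightarrow> real" and \<alpha> \<theta> :: real
  assumes U_meas: "U \<in> borel_measurable lborel"
      and U_bdd: "bounded (range U)"
      and U_supp: "\<exists>R. \<forall>x. \<bar>x\<bar> > R \<longrightarrow> U x = 0"
      and V_meas: "V \<in> borel_measurable lborel"
      and V_bdd: "bounded (range V)"
      and V_supp: "\<exists>R. \<forall>x. \<bar>x\<bar> > R \<longrightarrow> V x = 0"
      and V_deriv: "has_ac_deriv V V'"
      and V'_L2: "sq_integrable V'"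
      and a_pos: "\<forall>lam>0. a lam > 0"
      and alpha_pos: "\<alpha> > 0"
      and a_lim: "(a \<longlongrightarrow> \<alpha>) (at_right 0)"
      and u_hbs: "half_bound_state U u"
      and u_norm: "(u \<longlongrightarrow> 1) at_bot"
      and theta: "(u \<longlongrightarrow> \<theta>) at_top"
      and int0: "(LINT x|lborel. V (\<alpha> * x) * (u x)\<^sup>2) = 0"
      and intneg: "(LINT x|lborel. x * V' (\<alpha> * x) * (u x)\<^sup>2) < 0"
      and rate: "filterlim (\<lambda>lam. (a lam - \<alpha>) / lam powr (1/3)) at_top (at_right 0)"
  shows "coupling_constant_threshold (\<lambda>lam x. U x + lam * a lam * V (a lam * x)) \<and>
    (\<forall>e. threshold_eigenvalue (\<lambda>lam x. U x + lam * a lam * V (a lam * x)) e \<longrightarrow>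
       ((\<lambda>lam. e lam / (lam\<^sup>2 * (a lam - \<alpha>)\<^sup>2)) \<longlongrightarrow>
          - ((\<alpha> / (\<theta>\<^sup>2 + 1)) * (LINT x|lborel. x * V' (\<alpha> * x) * (u x)\<^sup>2))\<^sup>2) (at_right 0))"
proof -
  obtain B where B: "\<And>x. \<bar>U x\<bar> \<le> B" using U_bdd by (auto simp: bounded_iff)
  obtain M where M: "\<And>x. \<bar>V x\<bar> \<le> M" using V_bdd by (auto simp: bounded_iff)
  obtain R0 where R0: "\<And>x. \<bar>x\<bar> > R0 \<Longrightarrow> U x = 0" using U_supp by blast
  obtain \<rho> where \<rho>: "\<And>x. \<bar>x\<bar> > \<rho> \<Longrightarrow> V x = 0" using V_supp by blast
  have M0: "M \<ge> 0" using M[of 0] by linarith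
  have cV: "continuous_on UNIV V" by (rule has_ac_deriv_continuous[OF V_deriv])
  \<comment> \<open>One interval must serve all small \<open>lam\<close>: once a lam > \<alpha> / 2,
    the support of V (a lam x) lies within 2 \<rho> / \<alpha>. Adding 1 makes the inequalities
    strict.\<close>
  define R where "R = max (max R0 (2 * \<rho> / \<alpha>)) 0 + 1"
  have R: "R \<ge> 0" "R > R0" "R > 2 * \<rho> / \<alpha>" by (auto simp: R_def)
  have U0: "U x = 0" if "\<bar>x\<bar> \<ge> R" for x using R0[of x] R that by linarith
  have V0: "V (b * x) = 0" if "\<bar>x\<bar> \<ge> R" "b > \<alpha> / 2" for b x
  proof (rule \<rho>)
    have "\<rho> < \<alpha> / 2 * R" using R(3) alpha_pos by (simp add: field_simps)
    also have "\<dots> \<le> b * \<bar>x\<bar>" using that R(1) alpha_pos by (intro mult_mono) auto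
    finally show "\<bar>b * x\<bar> > \<rho>" using that alpha_pos by (simp add: abs_mult)
  qed
  obtain u1 where u: "sl_solution U u u1" using half_bound_state_solution[OF U_meas B u_hbs] by blast
  note cu = sl_solution_continuous[OF u]
  have ac_u: "has_ac_deriv u u1" using u by (simp add: sl_solution_def)
  have bcR: "u1 R = 0" "u R = \<theta>"
    by (rule sl_solution_const_right[OF u _ theta]; use U0 in simp)+
  have bcL: "u1 (-R) = 0" "u (-R) = 1"
    by (rule sl_solution_const_left[OF u _ u_norm]; use U0 in simp)+
  \<comment> \<open>If \<theta> were 0, u would have zero Cauchy data at R and vanish identically,
    contradicting u (-R) = 1.\<close>
  have \<theta>: "\<theta> \<noteq> 0"
    using sl_solution_unique[OF U_meas B u, of R "-R"] bcR bcL by auto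
  define I where "I = (LINT x|lborel. x * V' (\<alpha> * x) * (u x)\<^sup>2)"
  have I: "I < 0" using intneg by (simp add: I_def)
  \<comment> \<open>The integral of a non-integrable function is 0 by convention, so a negative
    value entails integrability.\<close>
  have int: "integrable lborel (\<lambda>x. x * V' (\<alpha> * x) * (u x)\<^sup>2)"
    using intneg not_integrable_integral_eq by fastforce
  define F where "F b = (\<integral>x. b * V (b * x) * (u x)\<^sup>2 \<partial>lborel)" for b
  \<comment> \<open>Integration by parts leaves the extra term with V (\<alpha> x) u^2, which is the
    integral assumed to be zero.\<close>
  have "DERIV F \<alpha> :> \<alpha> * I"
    using first_order_term_deriv[OF cV \<rho> ac_u cu(2) alpha_pos]
      integration_by_parts_scaled[OF V_deriv \<rho> ac_u cu(2) alpha_pos int] int0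
    by (simp add: F_def[abs_def] I_def)
  moreover have "F \<alpha> = 0" using int0 by (simp add: F_def mult.assoc)
  ultimately interpret threshold_scaling a F \<alpha> "\<alpha> * I"
    using a_lim rate by unfold_locales
  define S where "S = 1 + \<theta>\<^sup>2"
  have S: "S \<ge> 1" by (simp add: S_def)
  \<comment> \<open>With a lam < 2 \<alpha> and |V| <= M, the perturbation is at most A lam, which
    plays the role of \<eta>.\<close>
  define A where "A = 2 * \<alpha> * M"
  define w where "w lam x = lam * a lam * V (a lam * x)" for lam x
  define good where "good lam \<longleftrightarrow> lam > 0 \<and> \<alpha> / 2 < a lam \<and> a lam < 2 * \<alpha> \<and> A * lam \<le> 1" for lam
  have good: "\<forall>\<^sub>F lam in at_right 0. good lam"
  proof -
    have "\<forall>\<^sub>F lam in at_right 0. A * lam < 1"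
      using order_tendstoD(2)[OF tendsto_mult_right_zero[OF lam_tendsto_0, of A], of 1] by simp
    moreover have "\<forall>\<^sub>F lam in at_right 0. \<alpha> / 2 < a lam" "\<forall>\<^sub>F lam in at_right 0. a lam < 2 * \<alpha>"
      by (rule order_tendstoD[OF a_lim], use alpha_pos in simp)+
    ultimately show ?thesis
      using eventually_at_right_less[of "0::real"] by eventually_elim (simp add: good_def)
  qed
  have cw: "continuous_on UNIV (w lam)" for lam
    unfolding w_def by (intro continuous_intros continuous_on_compose2[OF cV]) auto
  have wb: "\<bar>w lam x\<bar> \<le> A * lam" if "good lam" for lam x
  proof -
    have "\<bar>w lam x\<bar> = lam * a lam * \<bar>V (a lam * x)\<bar>"
      using that alpha_pos by (simp add: w_def good_def abs_mult)
    also have "\<dots> \<le> lam * (2 * \<alpha>) * M"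
      using that alpha_pos M M0 by (intro mult_mono) (auto simp: good_def)
    finally show ?thesis by (simp add: A_def mult_ac)
  qed
  have W_meas: "(\<lambda>x. U x + w lam x) \<in> borel_measurable lborel" for lam
    using U_meas borel_measurable_continuous_onI[OF cw[of lam]] by simp
  have Wb: "\<bar>U x + w lam x\<bar> \<le> B + 1" if "good lam" for lam x
  proof -
    have "A * lam \<le> 1" using that by (simp add: good_def)
    then show ?thesis using B[of x] wb[OF that, of x] by linarith
  qed
  have W0: "U x + w lam x = 0" if "good lam" "\<bar>x\<bar> \<ge> R" for lam x
    using that by (simp add: w_def good_def U0 V0)
  have Fw: "(LINT x:{-R..R}|lborel. w lam x * (u x)\<^sup>2) = lam * F (a lam)" if "good lam" for lam
  proof -
    have "(LINT x:{-R..R}|lborel. w lam x * (u x)\<^sup>2) = (\<integral>x. w lam x * (u x)\<^sup>2 \<partial>lborel)"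
      by (intro integral_eq_set_integral_support[symmetric])
         (use that in \<open>auto simp: w_def good_def intro!: V0\<close>)
    then show ?thesis by (simp add: w_def F_def mult.assoc)
  qed
  obtain C where C: "C \<ge> 0"
    and est: "\<And>lam k f f1. good lam \<Longrightarrow> 0 \<le> k \<Longrightarrow> k \<le> 1 \<Longrightarrow>
     sl_solution (\<lambda>x. U x + w lam x + k\<^sup>2) f f1 \<Longrightarrow> f (-R) = 1 \<Longrightarrow> f1 (-R) = k \<Longrightarrow>
     \<bar>\<theta> * (f1 R + k * f R) - k * S - lam * F (a lam)\<bar> \<le> C * (k + A * lam)\<^sup>2"
  proof -
    obtain C where C: "C \<ge> 0" "\<forall>w \<eta> k f f1. continuous_on UNIV w \<longrightarrow> (\<forall>x. \<bar>w x\<bar> \<le> \<eta>) \<longrightarrow> \<eta> \<le> 1 \<longrightarrow> 0 \<le> k \<longrightarrow> k \<le> 1 \<longrightarrow>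
     sl_solution (\<lambda>x. U x + w x + k\<^sup>2) f f1 \<longrightarrow> f (-R) = 1 \<longrightarrow> f1 (-R) = k \<longrightarrow>
     \<bar>\<theta> * (f1 R + k * f R) - k * (1 + \<theta>\<^sup>2) - (LINT x:{-R..R}|lborel. w x * (u x)\<^sup>2)\<bar> \<le> C * (k + \<eta>)\<^sup>2"
      using characteristic_function_estimate[OF u R(1) B bcL(2,1) bcR(2,1)] by blast
    show thesis
    proof (rule that[OF C(1)])
      fix lam k :: real and f f1
      assume g: "good lam" and k: "0 \<le> k" "k \<le> 1" "sl_solution (\<lambda>x. U x + w lam x + k\<^sup>2) f f1" "f (-R) = 1" "f1 (-R) = k"
      have "A * lam \<le> 1" using g by (simp add: good_def)
      then show "\<bar>\<theta> * (f1 R + k * f R) - k * S - lam * F (a lam)\<bar> \<le> C * (k + A * lam)\<^sup>2"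
        using C(2)[rule_format, of "w lam" "A * lam" k f f1] cw wb[OF g] k Fw[OF g] by (simp add: S_def)
    qed
  qed

  have threshold: "coupling_constant_threshold (\<lambda>lam x. U x + w lam x)"
  proof -
    \<comment> \<open>The implication sits under the existential quantifiers so that solutions can
      be chosen as functions of all \<open>lam\<close> and k.\<close>
    have "\<exists>f f1. good lam \<longrightarrow> sl_solution (\<lambda>x. U x + w lam x + k\<^sup>2) f f1 \<and> f (-R) = 1 \<and> f1 (-R) = k" for lam k
    proof (cases "good lam")
      case True
      have "(\<lambda>x. U x + w lam x + k\<^sup>2) \<in> borel_measurable lborel" using W_meas[of lam] by simp
      moreover have "\<bar>U x + w lam x + k\<^sup>2\<bar> \<le> B + 1 + k\<^sup>2" for x
        using Wb[OF True, of x] abs_triangle_ineq[of "U x + w lam x" "k\<^sup>2"] by simp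
      ultimately show ?thesis using sl_solution_exists by blast
    qed simp
    then obtain f f1 where f: "\<And>lam k. good lam \<Longrightarrow> sl_solution (\<lambda>x. U x + w lam x + k\<^sup>2) (f lam k) (f1 lam k)"
      "\<And>lam k. good lam \<Longrightarrow> f lam k (-R) = 1" "\<And>lam k. good lam \<Longrightarrow> f1 lam k (-R) = k"
      by metis
    define D where "D lam k = \<theta> * (f1 lam k R + k * f lam k R)" for lam k
    have cD: "continuous_on X (D lam)" if "good lam" for lam X
    proof -
      have "continuous_on UNIV (\<lambda>k. f1 lam k R + k * f lam k R)"
        using characteristic_function_continuous[of "\<lambda>x. U x + w lam x" "B + 1" "-R" R "f lam" "f1 lam"]
          Wb[OF that] R(1) f[OF that] by simp
      then have "continuous_on UNIV (D lam)"
        unfolding D_def by (rule continuous_on_mult_left)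
      then show ?thesis by (rule continuous_on_subset) simp
    qed
    \<comment> \<open>The expected ratio of k to \<delta> = lam (a lam - \<alpha>). At m/2 and 2 m
      times \<delta> the rescaled characteristic function tends to \<alpha> I / 2 < 0 and -\<alpha>
      I > 0.\<close>
    define m where "m = - (\<alpha> * I) / S"
    have m: "m > 0" using I S alpha_pos by (simp add: m_def mult_pos_neg divide_neg_pos)
    have aI: "\<alpha> * I < 0" using I alpha_pos by (simp add: mult_pos_neg)
    have mS: "m * S = - (\<alpha> * I)" using S by (simp add: m_def)
    define \<delta> where "\<delta> lam = lam * (a lam - \<alpha>)" for lam
    have \<delta>0: "(\<delta> \<longlongrightarrow> 0) (at_right 0)"
      unfolding \<delta>_def using tendsto_mult[OF lam_tendsto_0 diff_tendsto_0] by simp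
    have \<delta>pos: "\<forall>\<^sub>F lam in at_right 0. \<delta> lam > 0"
      using a_gt eventually_at_right_less[of "0::real"] by eventually_elim (simp add: \<delta>_def)
    have lim: "((\<lambda>lam. D lam (c * \<delta> lam) / \<delta> lam) \<longlongrightarrow> c * S + \<alpha> * I) (at_right 0)" if c: "c > 0" for c
    proof -
      have "\<forall>\<^sub>F lam in at_right 0. c * \<delta> lam < 1"
        using order_tendstoD(2)[OF tendsto_mult_right_zero[OF \<delta>0, of c], of 1] by simp
      then have "\<forall>\<^sub>F lam in at_right 0. \<bar>D lam (c * \<delta> lam) - c * (lam * (a lam - \<alpha>)) * S - lam * F (a lam)\<bar>
          \<le> C * (c * (lam * (a lam - \<alpha>)) + A * lam)\<^sup>2"
        using good \<delta>pos
      proof eventually_elim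
        case (elim lam)
        then show ?case
          using est[of lam "c * \<delta> lam" "f lam (c * \<delta> lam)" "f1 lam (c * \<delta> lam)"] c f[of lam "c * \<delta> lam"]
          by (simp add: D_def \<delta>_def)
      qed
      then show ?thesis unfolding \<delta>_def by (rule sign_asymptotics)
    qed
    have neg: "\<forall>\<^sub>F lam in at_right 0. D lam (m/2 * \<delta> lam) / \<delta> lam < 0"
      by (rule order_tendstoD(2)[OF lim]) (use m mS aI in \<open>simp_all add: mult.commute[of I]\<close>)
    have pos: "\<forall>\<^sub>F lam in at_right 0. D lam (2 * m * \<delta> lam) / \<delta> lam > 0"
      by (rule order_tendstoD(1)[OF lim]) (use m mS aI in \<open>simp_all add: mult.assoc mult.commute[of I]\<close>)
    \<comment> \<open>The upper bound is kept in P so that any selection of roots tends to 0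
      together with \<delta>.\<close>
    define P where "P lam k \<longleftrightarrow> 0 < k \<and> k \<le> 2 * m * \<delta> lam \<and> schr_eigenvalue (\<lambda>x. U x + w lam x) (- (k\<^sup>2))" for lam k
    have ex: "\<forall>\<^sub>F lam in at_right 0. \<exists>k. P lam k"
      using neg pos good \<delta>pos
    proof eventually_elim
      case (elim lam)
      have "\<exists>k\<ge>m/2 * \<delta> lam. k \<le> 2 * m * \<delta> lam \<and> D lam k = 0"
        using elim m by (intro IVT' cD) (auto simp: divide_less_0_iff zero_less_divide_iff)
      then obtain k where k: "m/2 * \<delta> lam \<le> k" "k \<le> 2 * m * \<delta> lam" "D lam k = 0" by blast
      have k0: "k > 0" using k(1) m elim by (smt (verit) mult_pos_pos half_gt_zero)
      have "f1 lam k R + k * f lam k R = 0" using k(3) \<theta> by (simp add: D_def)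
      then have "schr_eigenvalue (\<lambda>x. U x + w lam x) (- (k\<^sup>2))"
        using elim(3) by (intro solution_imp_eigenvalue[OF f _ k0 W_meas Wb W0 R(1)]) auto
      then show ?case using k k0 by (auto simp: P_def)
    qed
    define K where "K lam = (SOME k. P lam k)" for lam
    have K: "\<forall>\<^sub>F lam in at_right 0. P lam (K lam)"
      using ex by eventually_elim (auto simp: K_def intro: someI_ex)
    have "((\<lambda>lam. 2 * m * \<delta> lam) \<longlongrightarrow> 0) (at_right 0)"
      using tendsto_mult_right_zero[OF \<delta>0] .
    then have "(K \<longlongrightarrow> 0) (at_right 0)"
      by (rule Lim_null_comparison[rotated]) (use K in \<open>auto simp: P_def elim: eventually_mono\<close>)
    then have "((\<lambda>lam. - ((K lam)\<^sup>2)) \<longlongrightarrow> - (0\<^sup>2)) (at_right 0)"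
      by (intro tendsto_intros)
    moreover have "\<forall>\<^sub>F lam in at_right 0. - ((K lam)\<^sup>2) < 0 \<and> schr_eigenvalue (\<lambda>x. U x + w lam x) (- ((K lam)\<^sup>2))"
      using K by eventually_elim (simp add: P_def)
    ultimately show ?thesis
      unfolding coupling_constant_threshold_def threshold_eigenvalue_def
      by (intro exI[of _ "\<lambda>lam. - ((K lam)\<^sup>2)"]) simp
  qed

  have asymp: "((\<lambda>lam. e lam / (lam\<^sup>2 * (a lam - \<alpha>)\<^sup>2)) \<longlongrightarrow> - ((\<alpha> / (\<theta>\<^sup>2 + 1)) * I)\<^sup>2) (at_right 0)"
    if e: "threshold_eigenvalue (\<lambda>lam x. U x + w lam x) e" for e
  proof -
    define k where "k lam = sqrt (- e lam)" for lam
    have e1: "\<forall>\<^sub>F lam in at_right 0. e lam < 0 \<and> schr_eigenvalue (\<lambda>x. U x + w lam x) (e lam)"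
      and e0: "(e \<longlongrightarrow> 0) (at_right 0)"
      using e by (auto simp: threshold_eigenvalue_def)
    have "((\<lambda>lam. sqrt (- e lam)) \<longlongrightarrow> sqrt (- 0)) (at_right 0)" by (intro tendsto_intros e0)
    then have k0: "(k \<longlongrightarrow> 0) (at_right 0)" by (simp add: k_def[abs_def])
    have k1: "\<forall>\<^sub>F lam in at_right 0. k lam < 1" using order_tendstoD(2)[OF k0, of 1] by simp
    have "\<forall>\<^sub>F lam in at_right 0. k lam > 0 \<and> \<bar>k lam * S + lam * F (a lam)\<bar> \<le> C * (k lam + A * lam)\<^sup>2"
      using e1 k1 good
    proof eventually_elim
      case (elim lam)
      have k: "k lam > 0" and ek: "e lam = - ((k lam)\<^sup>2)" using elim by (auto simp: k_def)
      obtain f f1 where f: "sl_solution (\<lambda>x. U x + w lam x + (k lam)\<^sup>2) f f1" "f (-R) = 1" "f1 (-R) = k lam" "f1 R + k lam * f R = 0"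
        using eigenvalue_imp_solution[OF _ k W_meas Wb[OF elim(3)] W0[OF elim(3)] R(1)] elim(1) ek by auto
      show ?case using est[OF elim(3) _ _ f(1-3)] k elim(2) f(4) by (simp add: abs_minus_commute)
    qed
    from root_asymptotics[OF S C k0 this]
    have "((\<lambda>lam. - ((k lam / (lam * (a lam - \<alpha>)))\<^sup>2)) \<longlongrightarrow> - ((- (\<alpha> * I) / S)\<^sup>2)) (at_right 0)"
      by (intro tendsto_minus tendsto_power)
    moreover have "\<forall>\<^sub>F lam in at_right 0. - ((k lam / (lam * (a lam - \<alpha>)))\<^sup>2) = e lam / (lam\<^sup>2 * (a lam - \<alpha>)\<^sup>2)"
      using e1 by eventually_elim (simp add: k_def power_divide power_mult_distrib)
    ultimately have "((\<lambda>lam. e lam / (lam\<^sup>2 * (a lam - \<alpha>)\<^sup>2)) \<longlongrightarrow> - ((- (\<alpha> * I) / S)\<^sup>2)) (at_right 0)"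
      by (rule Lim_transform_eventually)
    then show ?thesis by (simp add: S_def power_divide power_mult_distrib add.commute)
  qed
  show ?thesis using threshold asymp unfolding w_def I_def by blast
qed

end
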